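(* Let $\mu=\mathcal N(m_0,\Sigma_0)$ and $\nu=\mathcal N(m_1,\Sigma_1)$ be two nondegenerate Gaussian measures on $\mathbb R^n$, with $\Sigma_0\succ0$ and $\Sigma_1\succ0$. Then $$D_{\rm WKL}(\mu\,\|\,\nu)=\frac14\mathrm{Tr}\bigl(\Sigma_0-\Sigma_1+\Sigma_0R^2\log(R^2)\bigr)+\frac14\Bigl\lVert\sqrt{Q+2\log(R)^{\perp}}\,(m_1-m_0)\Bigr\rVert^2,$$ where $$R=\Sigma_0^{-1/2}\bigl(\Sigma_0^{1/2}\Sigma_1\Sigma_0^{1/2}\bigr)^{1/2}\Sigma_0^{-1/2},\qquad Q=(R-I)^{\dagger}\bigl(\log(R^2)R^2-R^2+I\bigr)(R-I)^{\dagger}.$$ Furthermore, if $\Sigma_0\Sigma_1=\Sigma_1\Sigma_0$, then $$D_{\rm WKL}(\mu\,\|\,\nu)=\frac14\Bigl(\bigl\lVert\sqrt Q\,(\sqrt{\Sigma_1}-\sqrt{\Sigma_0})\bigr\rVert_F^2+\bigl\lVert\sqrt{Q+2\log(R)^{\perp}}\,(m_1-m_0)\bigr\rVert^2\Bigr).$$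
   Context: $\lVert\cdot\rVert$ is the Euclidean norm, $\lVert\cdot\rVert_F$ the Frobenius norm. For a symmetric matrix $B$, $B^\dagger$ is the Moore--Penrose pseudoinverse and $B^\perp:=I-BB^\dagger$ is the orthogonal projector onto $\ker B$ (so $\log(R)^\perp$ is the orthogonal projector onto $\ker\log R$). Square roots of positive semidefinite matrices are the symmetric positive semidefinite ones and $\log$ of a positive definite matrix is the principal symmetric logarithm. Definition of $D_{\rm WKL}$. For $\mu=\mathcal N(m_0,\Sigma_0)$, $\nu=\mathcal N(m_1,\Sigma_1)$ with $\Sigma_0,\Sigma_1\succ0$, there is a unique quadratic function $f(x)=\frac12x^\top Ax+b^\top x$ with $A$ real symmetric and $b\in\mathbb R^n$ whose forward gradient flow $\frac{d}{dt}\varphi_t(x)=\nabla f(\varphi_t(x))=A\varphi_t(x)+b$, $\varphi_0(x)=x$, satisfies $(\varphi_1)_*\mu=\nu$ (push-forward of measures). Explicitly, $A=\log R$ with $R=\Sigma_0^{-1/2}(\Sigma_0^{1/2}\Sigma_1\Sigma_0^{1/2})^{1/2}\Sigma_0^{-1/2}$, and $b=K_1(A)^{-1}(m_1-Rm_0)$ with $K_1(A)=\int_0^1e^{sA}\,ds$. The Wasserstein KL divergence is $$D_{\rm WKL}(\mu\,\|\,\nu):=\int_{\mathbb R^n}\int_0^1\bigl(f(\varphi_1(x))-f(\varphi_t(x))\bigr)\,dt\,d\mu(x).$$ *)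

theory Defs
  imports "HOL-Analysis.Analysis" "HOL-Probability.Probability"
begin

definition sym_mat :: "real^'n^'n \<Rightarrow> bool" where
  "sym_mat A \<longleftrightarrow> transpose A = A"

definition psd_mat :: "real^'n^'n \<Rightarrow> bool" where
  "psd_mat A \<longleftrightarrow> sym_mat A \<and> (\<forall>x. 0 \<le> x \<bullet> (A *v x))"

definition pd_mat :: "real^'n^'n \<Rightarrow> bool" where
  "pd_mat A \<longleftrightarrow> sym_mat A \<and> (\<forall>x. x \<noteq> 0 \<longrightarrow> 0 < x \<bullet> (A *v x))"

definition mat_sqrt :: "real^'n^'n \<Rightarrow> real^'n^'n" where
  "mat_sqrt A = (THE B. psd_mat B \<and> B ** B = A)"

text \<open>The operations \<open>*\<close> and \<open>^\<close> on \<open>real^'n^'n\<close> act componentwise,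
  so matrix powers and the matrix exponential are built from \<open>**\<close>.\<close>

primrec mat_pow :: "real^'n^'n \<Rightarrow> nat \<Rightarrow> real^'n^'n" where
  "mat_pow A 0 = mat 1"
| "mat_pow A (Suc k) = A ** mat_pow A k"

definition mat_exp :: "real^'n^'n \<Rightarrow> real^'n^'n" where
  "mat_exp A = (\<Sum>k. (1 / fact k) *\<^sub>R mat_pow A k)"

text \<open>Principal symmetric logarithm; the definite description is uniquely satisfied
  for positive definite \<open>B\<close>.\<close>

definition mat_log :: "real^'n^'n \<Rightarrow> real^'n^'n" where
  "mat_log B = (THE A. sym_mat A \<and> mat_exp A = B)"

definition mat_pinv :: "real^'n^'n \<Rightarrow> real^'n^'n" where
  "mat_pinv B = (THE X. B ** X ** B = B \<and> X ** B ** X = X \<and>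
     transpose (B ** X) = B ** X \<and> transpose (X ** B) = X ** B)"

definition mat_perp :: "real^'n^'n \<Rightarrow> real^'n^'n" where
  "mat_perp B = mat 1 - B ** mat_pinv B"

text \<open>The library norm on \<open>real^'n^'m\<close> is the Frobenius norm.\<close>

lemma norm_matrix_eq_frobenius:
  fixes A :: "real^'n^'m"
  shows "norm A = sqrt (\<Sum>i\<in>UNIV. \<Sum>j\<in>UNIV. (A $ i $ j)\<^sup>2)"
  by (simp add: norm_vec_def L2_set_def sum_nonneg)

definition gaussian :: "real^'n \<Rightarrow> real^'n^'n \<Rightarrow> (real^'n) measure" where
  "gaussian m S = density lborel (\<lambda>x. ennreal
     (exp (- ((x - m) \<bullet> (matrix_inv S *v (x - m))) / 2) / sqrt ((2 * pi) ^ CARD('n) * det S)))"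

definition quadratic_potential :: "(real^'n \<Rightarrow> real) \<Rightarrow> bool" where
  "quadratic_potential f \<longleftrightarrow>
     (\<exists>A b. sym_mat A \<and> f = (\<lambda>x. (1/2) * (x \<bullet> (A *v x)) + b \<bullet> x))"

definition is_gradient_flow :: "('a::real_inner \<Rightarrow> real) \<Rightarrow> (real \<Rightarrow> 'a \<Rightarrow> 'a) \<Rightarrow> bool" where
  "is_gradient_flow f \<phi> \<longleftrightarrow> (\<forall>x. \<phi> 0 x = x) \<and>
     (\<forall>t x. \<exists>v. GDERIV f (\<phi> t x) :> v \<and> ((\<lambda>s. \<phi> s x) has_vector_derivative v) (at t))"

text \<open>For a quadratic potential the flow equation is affine linear, so there is exactly one global
  flow, defined for all real times.\<close>

definition gradient_flow :: "('a::real_inner \<Rightarrow> real) \<Rightarrow> real \<Rightarrow> 'a \<Rightarrow> 'a" where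
  "gradient_flow f = (THE \<phi>. is_gradient_flow f \<phi>)"

text \<open>For nondegenerate Gaussian \<open>\<mu>\<close> and \<open>\<nu>\<close> there is exactly one potential as below; on other
  measures the following two constants carry no meaning.\<close>

definition wkl_potential :: "(real^'n) measure \<Rightarrow> (real^'n) measure \<Rightarrow> real^'n \<Rightarrow> real" where
  "wkl_potential \<mu> \<nu> =
     (THE f. quadratic_potential f \<and> distr \<mu> borel (gradient_flow f 1) = \<nu>)"

definition D_WKL :: "(real^'n) measure \<Rightarrow> (real^'n) measure \<Rightarrow> real" where
  "D_WKL \<mu> \<nu> =
     (let f = wkl_potential \<mu> \<nu>; \<phi> = gradient_flow f
      in (\<integral>x. (LBINT t:{0..1}. f (\<phi> 1 x) - f (\<phi> t x)) \<partial>\<mu>))"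

end

theory Submission
  imports Defs
begin

text \<open>
The divergence decouples in an eigenbasis of the transport matrix \<open>R\<close>. The potential that drives
the first Gaussian to the second is \<open>f(x) = (1/2) x \<bullet> A x + b \<bullet> x\<close> with \<open>A = log R\<close>: its flow is
affine with linear part \<open>exp (t A)\<close>, Gaussians are determined by mean and covariance
(\<open>gaussian_inject\<close>), and the only positive definite \<open>X\<close> with \<open>X S0 X = S1\<close> is \<open>R\<close>
(\<open>transport_mat_unique\<close>). Hence both definite descriptions, that of the flow and that of the
potential, denote (\<open>gradient_flow_quadratic\<close>, \<open>wkl_potential_gaussian\<close>).

Along the flow \<open>f\<close> increases at the rate \<open>\<parallel>\<nabla>f\<parallel>\<^sup>2\<close>, and in eigencoordinates the gradient at time
\<open>s\<close> is \<open>exp (a s) (a x + b)\<close>. Averaging over the starting time of the increase gives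
\<open>w(a) (a x + b)\<^sup>2\<close>, where \<open>w(a)\<close> is the integral of \<open>s exp (2 a s)\<close> over the unit interval
(\<open>potential_drop_integral\<close>). Its expectation under the first Gaussian is \<open>w(a)\<close> times the sum
of the variance \<open>a\<^sup>2 (u \<bullet> S0 u)\<close>, where \<open>u\<close> is the unit eigenvector, and of the squared mean of
\<open>a x + b\<close> (\<open>gaussian_affine_square\<close>). With \<open>r = exp a\<close> one has
\<open>4 a\<^sup>2 w(a) = r\<^sup>2 log r\<^sup>2 - r\<^sup>2 + 1\<close>; the variances add up to the trace term, because
\<open>Tr S1 = Tr (S0 R\<^sup>2)\<close>. Since the flow matches the means, the mean of \<open>a x + b\<close> is \<open>a / (r - 1)\<close> times
the mean difference, or the mean difference itself when \<open>a = 0\<close>. The first case is the quadratic form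
of \<open>Q\<close>, the second, with \<open>w(0) = 1/2\<close>, that of twice the projector onto the kernel of \<open>log R\<close>
(\<open>wkl_weight_mean\<close>).

If the covariances commute then \<open>R S0\<^sup>1\<^sup>/\<^sup>2 = S1\<^sup>1\<^sup>/\<^sup>2\<close>, so the Frobenius norm is the trace of
\<open>S0 (R - 1) Q (R - 1)\<close>, where the factors \<open>R - 1\<close> cancel the pseudoinverses: the remaining function
of \<open>r\<close> vanishes at \<open>r = 1\<close>.

Square roots, exponentials, logarithms and pseudoinverses are all evaluated through the spectral
theorem \<open>sym_mat_spectral\<close>; their independence of the eigenbasis is \<open>spec_transfer\<close>.
\<close>

section \<open>The spectral theorem for real symmetric matrices\<close>

lemma inner_sym_mat:
  assumes "sym_mat A"
  shows "x \<bullet> (A *v y) = (A *v x) \<bullet> y"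
  using assms by (metis dot_lmul_matrix inner_commute sym_mat_def transpose_matrix_vector)

text \<open>A maximiser \<open>v\<close> of the quadratic form on the unit sphere of \<open>S\<close>, with maximal value
\<open>c\<close>, is an eigenvector: the form \<open>c \<parallel>y\<parallel>\<^sup>2 - y \<bullet> A y\<close> is nonnegative on \<open>S\<close> and vanishes at
\<open>v\<close>, so \<open>v\<close> lies in its radical, and \<open>z = c v - A v\<close>, which belongs to the invariant subspace
\<open>S\<close>, is orthogonal to itself.\<close>

lemma sym_mat_eigenvector_in_subspace:
  fixes A :: "real^'n^'n"
  assumes sym: "sym_mat A" and S: "subspace S" and inv: "\<And>x. x \<in> S \<Longrightarrow> A *v x \<in> S"
    and ne: "S \<noteq> {0}"
  obtains v c where "v \<in> S" "norm v = 1" "A *v v = c *\<^sub>R v"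
proof -
  let ?K = "S \<inter> sphere 0 1"
  obtain w where w: "w \<in> S" "w \<noteq> 0" using ne subspace_0[OF S] by blast
  have "(1 / norm w) *\<^sub>R w \<in> ?K" using w S by (auto simp: subspace_scale)
  then have Kne: "?K \<noteq> {}" by blast
  have Kc: "compact ?K" using closed_subspace[OF S] by (metis Int_commute compact_Int_closed compact_sphere)
  have "continuous_on ?K (\<lambda>x. x \<bullet> (A *v x))"
    by (intro continuous_intros linear_continuous_on) simp
  from continuous_attains_sup[OF Kc Kne this] obtain v where v: "v \<in> ?K"
    and max: "\<And>y. y \<in> ?K \<Longrightarrow> y \<bullet> (A *v y) \<le> v \<bullet> (A *v v)" by blast
  define c where "c = v \<bullet> (A *v v)"
  define B where "B x y = c * (x \<bullet> y) - x \<bullet> (A *v y)" for x y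
  have nonneg: "0 \<le> B y y" if y: "y \<in> S" for y
  proof (cases "y = 0")
    case False
    then have "(1 / norm y) *\<^sub>R y \<in> ?K" using y S by (auto simp: subspace_scale)
    from max[OF this] have "(y \<bullet> (A *v y)) / (norm y)\<^sup>2 \<le> c"
      by (simp add: c_def matrix_vector_mult_scaleR power2_eq_square)
    with False show ?thesis
      by (simp add: B_def divide_le_eq dot_square_norm)
  qed (simp add: B_def)
  have v1: "v \<bullet> v = 1" "v \<in> S" using v by (auto simp: dot_square_norm)
  have Bvv: "B v v = 0" by (simp add: B_def v1 c_def)
  define z where "z = c *\<^sub>R v - A *v v"
  have z: "z \<in> S" unfolding z_def using S v1 inv by (simp add: subspace_diff subspace_scale)
  have Bz: "B z v = z \<bullet> z"
  proof -
    have "B z v = z \<bullet> (c *\<^sub>R v - A *v v)" by (simp only: B_def inner_diff_right inner_scaleR_right)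
    then show ?thesis by (simp only: z_def)
  qed
  have expand: "B (v + t *\<^sub>R z) (v + t *\<^sub>R z) = 2 * t * (z \<bullet> z) + t\<^sup>2 * B z z" for t
  proof -
    have "B v z = B z v" 
      using inner_sym_mat[OF sym, of v z] by (simp add: B_def inner_commute)
    moreover have "B (v + t *\<^sub>R z) (v + t *\<^sub>R z) = B v v + t * B v z + t * B z v + t\<^sup>2 * B z z"
      by (simp add: B_def algebra_simps matrix_vector_right_distrib matrix_vector_mult_scaleR
          inner_add_left inner_add_right power2_eq_square)
    ultimately show ?thesis using Bvv Bz by simp
  qed
  have "z \<bullet> z = 0"
  proof (rule ccontr)
    assume "z \<bullet> z \<noteq> 0"
    then have pos: "z \<bullet> z > 0" by simp
    \<comment> \<open>A small negative step makes the linear term dominate; the summand 1 only avoids division by 0.\<close>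
    define t where "t = - (z \<bullet> z) / (B z z + 1)"
    have Bzz: "B z z \<ge> 0" using nonneg z by blast
    have "0 \<le> B (v + t *\<^sub>R z) (v + t *\<^sub>R z)"
      using nonneg z v1 S by (simp add: subspace_add subspace_scale)
    then have "0 \<le> t * (2 * (z \<bullet> z) + t * B z z)" unfolding expand by (simp add: algebra_simps power2_eq_square)
    moreover have "t < 0" using pos Bzz by (simp add: t_def field_simps)
    moreover have "- t * B z z \<le> z \<bullet> z" using pos Bzz by (simp add: t_def field_simps)
    then have "2 * (z \<bullet> z) + t * B z z > 0" using pos by linarith
    ultimately show False by (simp add: zero_le_mult_iff)
  qed
  then have "A *v v = c *\<^sub>R v" by (simp add: z_def)
  moreover have "norm v = 1" using v by simp
  ultimately show thesis using that v1 by blast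
qed

text \<open>An orthonormal family of eigenvectors of maximal size spans: otherwise its orthogonal
complement is a nonzero invariant subspace, which contains a further eigenvector.\<close>

lemma sym_mat_eigenbasis:
  fixes A :: "real^'n^'n"
  assumes sym: "sym_mat A"
  obtains B where "pairwise orthogonal B" "\<And>b. b \<in> B \<Longrightarrow> norm b = 1"
    "\<And>b. b \<in> B \<Longrightarrow> \<exists>c. A *v b = c *\<^sub>R b" "card B = CARD('n)"
proof -
  define P where "P B \<longleftrightarrow> pairwise orthogonal B \<and> (\<forall>b\<in>B. norm b = 1 \<and> (\<exists>c. A *v b = c *\<^sub>R b))" for B
  have ind: "independent B" if "P B" for B
    using that by (intro pairwise_orthogonal_independent) (auto simp: P_def)
  have "P {}" by (simp add: P_def pairwise_def)
  moreover have "\<forall>B. P B \<longrightarrow> card B < DIM(real^'n) + 1"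
    using ind independent_bound by (fastforce simp del: DIM_cart)
  ultimately obtain B where B: "P B" and max: "\<And>C. P C \<Longrightarrow> card C \<le> card B"
    using Lattices_Big.ex_has_greatest_nat[of P "{}" card "DIM(real^'n) + 1"] by blast
  have "span B = UNIV"
  proof (rule ccontr)
    assume "span B \<noteq> UNIV"
    then obtain a where a: "a \<noteq> 0" "\<And>x. x \<in> span B \<Longrightarrow> a \<bullet> x = 0"
      using span_not_UNIV_orthogonal[of B] by blast
    define S where "S = {x. \<forall>b\<in>B. x \<bullet> b = 0}"
    have S: "subspace S" by (auto simp: S_def subspace_def inner_add_left)
    have inv: "A *v x \<in> S" if "x \<in> S" for x
    proof -
      have "(A *v x) \<bullet> b = 0" if b: "b \<in> B" for b
      proof -
        obtain c where "A *v b = c *\<^sub>R b" using B b unfolding P_def by blast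
        then show ?thesis using \<open>x \<in> S\<close> b inner_sym_mat[OF sym, of x b] by (simp add: S_def)
      qed
      then show ?thesis by (simp add: S_def)
    qed
    have "a \<in> S" using a by (auto simp: S_def intro: span_base)
    then have "S \<noteq> {0}" using a by blast
    from sym_mat_eigenvector_in_subspace[OF sym S inv this] obtain v c
      where v: "v \<in> S" "norm v = 1" "A *v v = c *\<^sub>R v" by blast
    have "v \<notin> B" using v by (auto simp: S_def)
    moreover have "P (insert v B)" using B v
      by (auto simp: P_def pairwise_insert orthogonal_def S_def inner_commute)
    moreover have "finite B" using ind[OF B] independent_bound by blast
    ultimately show False using max[of "insert v B"] by simp
  qed
  then have "dim B = DIM(real^'n)" by (metis dim_UNIV dim_span)
  then have "card B = CARD('n)" using dim_eq_card_independent[OF ind[OF B]] by simp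
  moreover have "pairwise orthogonal B" "\<And>b. b \<in> B \<Longrightarrow> norm b = 1"
    "\<And>b. b \<in> B \<Longrightarrow> \<exists>c. A *v b = c *\<^sub>R b"
    using B by (simp_all add: P_def)
  ultimately show thesis using that by blast
qed

definition diag_mat :: "('n \<Rightarrow> real) \<Rightarrow> real^'n^'n" where
  "diag_mat d = (\<chi> i j. if i = j then d i else 0)"

text \<open>The matrix with eigenvalues \<open>d i\<close> on the columns of \<open>U\<close>. Every matrix function below is
reduced to a function of the eigenvalue family \<open>d\<close>, and \<open>x v* U\<close> is the vector of coordinates of
\<open>x\<close> in this eigenbasis.\<close>

definition spectral_mat :: "real^'n^'n \<Rightarrow> ('n \<Rightarrow> real) \<Rightarrow> real^'n^'n" where
  "spectral_mat U d = U ** diag_mat d ** transpose U"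

lemma diag_mat_vec [simp]: "(diag_mat d *v x) $ i = d i * x $ i"
  by (simp add: diag_mat_def matrix_vector_mult_def if_distrib[of "\<lambda>y. y * _"] cong: if_cong)

lemma matrix_diag_mat_nth [simp]: "(M ** diag_mat d) $ i $ j = M $ i $ j * d j"
  by (simp add: diag_mat_def matrix_matrix_mult_def if_distrib cong: if_cong)

lemma diag_mat_matrix_nth [simp]: "(diag_mat d ** M) $ i $ j = d i * M $ i $ j"
  by (simp add: diag_mat_def matrix_matrix_mult_def if_distrib[of "\<lambda>y. y * _"] cong: if_cong)

lemma diag_mat_nth: "diag_mat d $ i $ j = (if i = j then d i else 0)"
  by (simp add: diag_mat_def)

theorem sym_mat_spectral:
  fixes A :: "real^'n^'n"
  assumes sym: "sym_mat A"
  obtains U d where "orthogonal_matrix U" "A = spectral_mat U d"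
proof -
  obtain B where B: "pairwise orthogonal B" "\<And>b. b \<in> B \<Longrightarrow> norm b = 1"
    "\<And>b. b \<in> B \<Longrightarrow> \<exists>c. A *v b = c *\<^sub>R b" "card B = CARD('n)"
    using sym_mat_eigenbasis[OF sym] by blast
  have "finite B" using B(4) by (metis card.infinite zero_less_card_finite less_irrefl)
  then obtain u :: "'n \<Rightarrow> real^'n" where u: "bij_betw u UNIV B"
    using B(4) finite_same_card_bij[of "UNIV :: 'n set" B] by auto
  have "u i \<in> B" for i using u by (simp add: bij_betw_apply)
  then have "\<forall>i. \<exists>c. A *v u i = c *\<^sub>R u i" using B(3) by blast
  then obtain d where d: "\<And>i. A *v u i = d i *\<^sub>R u i" by (auto dest!: choice)
  define U :: "real^'n^'n" where "U = (\<chi> i j. u j $ i)"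
  have col: "column i U = u i" for i by (simp add: U_def column_def vec_eq_iff)
  have orth: "orthogonal_matrix U"
    unfolding orthogonal_matrix_orthonormal_columns col
    using B(1,2) u unfolding pairwise_def bij_betw_def inj_on_def by blast
  have "A ** U = U ** diag_mat d"
  proof -
    have "(A ** U) $ i $ j = (A *v u j) $ i" for i j
      by (simp add: matrix_matrix_mult_def matrix_vector_mult_def U_def)
    then show ?thesis by (simp add: vec_eq_iff d U_def mult.commute)
  qed
  then have "A ** U ** transpose U = spectral_mat U d" by (simp add: spectral_mat_def)
  then have "A = spectral_mat U d"
    using orth by (simp add: orthogonal_matrix_def matrix_mul_assoc[symmetric])
  with orth show thesis using that by blast
qed

section \<open>Calculus of simultaneously diagonalised matrices\<close>

lemma diag_mat_mult: "diag_mat d ** diag_mat e = diag_mat (\<lambda>i. d i * e i)"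
  by (simp add: vec_eq_iff diag_mat_nth)

lemma transpose_spec [simp]: "transpose (spectral_mat U d) = spectral_mat U d"
proof -
  have "transpose (diag_mat d) = diag_mat d" by (simp add: vec_eq_iff diag_mat_nth transpose_def)
  then show ?thesis by (simp add: spectral_mat_def matrix_transpose_mul matrix_mul_assoc)
qed

lemma sym_mat_spec [simp]: "sym_mat (spectral_mat U d)"
  by (simp add: sym_mat_def)

lemma spec_mult:
  assumes "orthogonal_matrix U"
  shows "spectral_mat U d ** spectral_mat U e = spectral_mat U (\<lambda>i. d i * e i)"
proof -
  have "spectral_mat U d ** spectral_mat U e = U ** diag_mat d ** (transpose U ** U) ** diag_mat e ** transpose U"
    by (simp add: spectral_mat_def matrix_mul_assoc)
  also have "\<dots> = U ** (diag_mat d ** diag_mat e) ** transpose U"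
    using assms by (simp add: orthogonal_matrix_def matrix_mul_assoc)
  finally show ?thesis by (simp add: spectral_mat_def diag_mat_mult)
qed

lemma spec_nth:
  fixes U :: "real^'n^'n"
  shows "spectral_mat U d $ i $ j = (\<Sum>k\<in>UNIV. U $ i $ k * d k * U $ j $ k)"
proof -
  have "(M ** transpose U) $ i $ j = (\<Sum>k\<in>UNIV. M $ i $ k * U $ j $ k)" for M :: "real^'n^'n"
    by (simp add: matrix_matrix_mult_def transpose_def)
  then show ?thesis by (simp add: spectral_mat_def)
qed

lemma spec_add: "spectral_mat U d + spectral_mat U e = spectral_mat U (\<lambda>i. d i + e i)"
  by (simp add: vec_eq_iff spec_nth sum.distrib[symmetric] algebra_simps)

lemma spec_diff: "spectral_mat U d - spectral_mat U e = spectral_mat U (\<lambda>i. d i - e i)"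
  by (simp add: vec_eq_iff spec_nth sum_subtractf[symmetric] algebra_simps)

lemma spec_scaleR: "c *\<^sub>R spectral_mat U d = spectral_mat U (\<lambda>i. c * d i)"
  by (simp add: vec_eq_iff spec_nth sum_distrib_left mult_ac)

lemma spec_one:
  fixes U :: "real^'n^'n"
  assumes "orthogonal_matrix U"
  shows "spectral_mat U (\<lambda>i. 1) = mat 1"
proof -
  have "diag_mat (\<lambda>i::'n. 1) = (mat 1 :: real^'n^'n)" by (simp add: vec_eq_iff diag_mat_nth mat_def)
  then show ?thesis using assms by (simp add: spectral_mat_def orthogonal_matrix_def)
qed

lemma coord_spec:
  assumes "orthogonal_matrix U"
  shows "((spectral_mat U d *v x) v* U) $ i = d i * (x v* U) $ i"
proof -
  have "transpose U *v (spectral_mat U d *v x) = ((transpose U ** U) ** diag_mat d ** transpose U) *v x"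
    unfolding spectral_mat_def by (simp only: matrix_vector_mul_assoc matrix_mul_assoc)
  also have "\<dots> = diag_mat d *v (transpose U *v x)"
    using assms by (simp only: orthogonal_matrix_def matrix_vector_mul_assoc matrix_mul_lid)
  finally show ?thesis by (simp add: vec_eq_iff)
qed

lemma inner_coord:
  fixes U :: "real^'n^'n"
  assumes "orthogonal_matrix U"
  shows "x \<bullet> y = (\<Sum>i\<in>UNIV. (x v* U) $ i * (y v* U) $ i)"
proof -
  have "(x v* U) \<bullet> (y v* U) = x \<bullet> (U *v (transpose U *v y))"
    by (simp add: dot_lmul_matrix)
  also have "\<dots> = x \<bullet> y"
    using assms by (simp only: orthogonal_matrix_def matrix_vector_mul_assoc matrix_vector_mul_lid)
  finally show ?thesis by (simp add: inner_vec_def[of "x v* U"])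
qed

lemma coord_eqI:
  fixes U :: "real^'n^'n"
  assumes U: "orthogonal_matrix U" and "\<And>i. (x v* U) $ i = (y v* U) $ i"
  shows "x = y"
proof -
  have "x v* U = y v* U" using assms(2) by (simp add: vec_eq_iff)
  then have "(x v* U) v* transpose U = (y v* U) v* transpose U" by simp
  then show ?thesis using U
    by (simp only: orthogonal_matrix_def vector_matrix_mul_assoc vector_matrix_mul_rid)
qed

lemma quad_spec:
  assumes "orthogonal_matrix U"
  shows "x \<bullet> (spectral_mat U d *v x) = (\<Sum>i\<in>UNIV. d i * ((x v* U) $ i)\<^sup>2)"
  by (simp only: inner_coord[OF assms] coord_spec[OF assms]) (simp add: power2_eq_square mult_ac)

lemma coord_column:
  fixes U :: "real^'n^'n"
  assumes "orthogonal_matrix U"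
  shows "(column k U v* U) $ i = (if i = k then 1 else 0)"
proof -
  have "(column k U v* U) $ i = (transpose U ** U) $ i $ k"
    by (simp add: column_def vector_matrix_mult_def matrix_matrix_mult_def transpose_def mult.commute)
  then show ?thesis using assms by (simp add: orthogonal_matrix_def mat_def)
qed

lemma quad_spec_column:
  assumes "orthogonal_matrix U"
  shows "column k U \<bullet> (spectral_mat U d *v column k U) = d k"
  by (simp only: quad_spec[OF assms] coord_column[OF assms]) (simp add: if_distrib[of "\<lambda>y. y\<^sup>2"] if_distrib[of "\<lambda>y. _ * y"] cong: if_cong)

lemma column_nonzero: "orthogonal_matrix U \<Longrightarrow> column k (U :: real^'n^'n) \<noteq> 0"
  by (metis norm_zero orthogonal_matrix_orthonormal_columns zero_neq_one)

lemma psd_spec_iff: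
  assumes "orthogonal_matrix U"
  shows "psd_mat (spectral_mat U d) \<longleftrightarrow> (\<forall>i. 0 \<le> d i)"
proof
  assume "psd_mat (spectral_mat U d)"
  then show "\<forall>i. 0 \<le> d i" unfolding psd_mat_def by (metis quad_spec_column[OF assms])
qed (simp add: psd_mat_def quad_spec[OF assms] sum_nonneg)

lemma pd_spec_iff:
  assumes U: "orthogonal_matrix U"
  shows "pd_mat (spectral_mat U d) \<longleftrightarrow> (\<forall>i. 0 < d i)"
proof
  assume "pd_mat (spectral_mat U d)"
  then show "\<forall>i. 0 < d i" unfolding pd_mat_def
    by (metis quad_spec_column[OF U] column_nonzero[OF U])
next
  assume d: "\<forall>i. 0 < d i"
  have "0 < x \<bullet> (spectral_mat U d *v x)" if "x \<noteq> 0" for x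
  proof -
    have "\<exists>i. (x v* U) $ i \<noteq> 0"
    proof (rule ccontr)
      assume "\<nexists>i. (x v* U) $ i \<noteq> 0"
      then have "x = 0" by (intro coord_eqI[OF U]) simp
      with that show False by simp
    qed
    then obtain i where "(x v* U) $ i \<noteq> 0" by blast
    then have "0 < d i * ((x v* U) $ i)\<^sup>2" using d by simp
    then show ?thesis unfolding quad_spec[OF U]
      using d by (intro sum_pos2[where i = i]) (simp_all add: less_imp_le)
  qed
  then show "pd_mat (spectral_mat U d)" by (simp add: pd_mat_def)
qed

text \<open>By cyclicity of the trace, the diagonal entries of \<open>U\<^sup>T S U\<close> are paired with the eigenvalues.\<close>

lemma trace_mult_spec:
  fixes U :: "real^'n^'n"
  shows "trace (S ** spectral_mat U d) = (\<Sum>k\<in>UNIV. d k * (column k U \<bullet> (S *v column k U)))"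
proof -
  have "trace (S ** spectral_mat U d) = trace ((S ** U ** diag_mat d) ** transpose U)"
    by (simp add: spectral_mat_def matrix_mul_assoc)
  also have "\<dots> = trace (transpose U ** (S ** U ** diag_mat d))" by (rule trace_mul_sym)
  also have "\<dots> = trace ((transpose U ** (S ** U)) ** diag_mat d)" by (simp add: matrix_mul_assoc)
  also have "\<dots> = (\<Sum>k\<in>UNIV. (transpose U ** (S ** U)) $ k $ k * d k)" by (simp add: trace_def)
  also have "\<dots> = (\<Sum>k\<in>UNIV. d k * (column k U \<bullet> (S *v column k U)))"
    by (intro sum.cong refl)
      (simp add: matrix_matrix_mult_def matrix_vector_mult_def transpose_def column_def inner_vec_def)
  finally show ?thesis .
qed

text \<open>Functional calculus does not depend on the chosen eigenbasis. With \<open>M = U\<^sup>T V\<close>, equality of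
two spectral matrices with eigenvalues \<open>\<alpha>\<close> and \<open>\<beta>\<close> says entrywise that
\<open>\<alpha> i * M i j = M i j * \<beta> j\<close>, and off
the zeros of \<open>M\<close> this forces \<open>\<alpha> i = \<beta> j\<close>, which any function determined by these values
preserves. With \<open>g\<close> the square or the exponential
this yields uniqueness of square roots and of logarithms.\<close>

lemma spec_transfer:
  assumes U: "orthogonal_matrix U" and V: "orthogonal_matrix V"
    and eq: "spectral_mat U (\<lambda>i. g (d i)) = spectral_mat V (\<lambda>i. g (e i))"
    and inj: "\<And>i j. g (d i) = g (e j) \<Longrightarrow> h (d i) = h (e j)"
  shows "spectral_mat U (\<lambda>i. h (d i)) = spectral_mat V (\<lambda>i. h (e i))"
proof -
  define M where "M = transpose U ** V"
  have conv: "spectral_mat U a = spectral_mat V b \<longleftrightarrow> (\<forall>i j. a i * M $ i $ j = M $ i $ j * b j)" for a b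
  proof -
    have "spectral_mat U a = spectral_mat V b \<longleftrightarrow> transpose U ** spectral_mat U a ** V = transpose U ** spectral_mat V b ** V"
    proof
      assume "transpose U ** spectral_mat U a ** V = transpose U ** spectral_mat V b ** V"
      then have "U ** (transpose U ** spectral_mat U a ** V) ** transpose V
        = U ** (transpose U ** spectral_mat V b ** V) ** transpose V" by simp
      then have "(U ** transpose U) ** spectral_mat U a ** (V ** transpose V)
        = (U ** transpose U) ** spectral_mat V b ** (V ** transpose V)" by (simp only: matrix_mul_assoc)
      then show "spectral_mat U a = spectral_mat V b" using U V by (simp add: orthogonal_matrix_def)
    qed simp
    also have "transpose U ** spectral_mat U a ** V = (transpose U ** U) ** diag_mat a ** M"
      by (simp add: spectral_mat_def M_def matrix_mul_assoc)
    also have "\<dots> = diag_mat a ** M" using U by (simp add: orthogonal_matrix_def)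
    also have "transpose U ** spectral_mat V b ** V = M ** diag_mat b ** (transpose V ** V)"
      by (simp add: spectral_mat_def M_def matrix_mul_assoc)
    also have "\<dots> = M ** diag_mat b" using V by (simp add: orthogonal_matrix_def)
    finally show ?thesis by (simp add: vec_eq_iff)
  qed
  have entry: "h (d i) * M $ i $ j = M $ i $ j * h (e j)" for i j
  proof (cases "M $ i $ j = 0")
    case False
    moreover have "g (d i) * M $ i $ j = M $ i $ j * g (e j)" using eq conv[of "\<lambda>i. g (d i)" "\<lambda>i. g (e i)"] by simp
    ultimately have "g (d i) = g (e j)" by simp
    then show ?thesis using inj[of i j] by simp
  qed simp
  then show ?thesis using conv[of "\<lambda>i. h (d i)" "\<lambda>i. h (e i)"] by simp
qed

text \<open>In the eigenbasis, commuting with a diagonal matrix forces the entries that link different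
eigenvalues to vanish; these are the only entries that obstruct commuting with a function of that
diagonal matrix.\<close>

lemma commute_spec:
  assumes U: "orthogonal_matrix U" and comm: "N ** spectral_mat U d = spectral_mat U d ** N"
    and inj: "\<And>i j. d i = d j \<Longrightarrow> h i = h j"
  shows "N ** spectral_mat U h = spectral_mat U h ** N"
proof -
  define M where "M = transpose U ** N ** U"
  have conv: "N ** spectral_mat U a = spectral_mat U a ** N \<longleftrightarrow> (\<forall>i j. M $ i $ j * a j = a i * M $ i $ j)" for a
  proof -
    have "N ** spectral_mat U a = spectral_mat U a ** N \<longleftrightarrow>
      transpose U ** (N ** spectral_mat U a) ** U = transpose U ** (spectral_mat U a ** N) ** U"
    proof
      assume "transpose U ** (N ** spectral_mat U a) ** U = transpose U ** (spectral_mat U a ** N) ** U"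
      then have "U ** (transpose U ** (N ** spectral_mat U a) ** U) ** transpose U
        = U ** (transpose U ** (spectral_mat U a ** N) ** U) ** transpose U" by simp
      then have "(U ** transpose U) ** (N ** spectral_mat U a) ** (U ** transpose U)
        = (U ** transpose U) ** (spectral_mat U a ** N) ** (U ** transpose U)" by (simp only: matrix_mul_assoc)
      then show "N ** spectral_mat U a = spectral_mat U a ** N" using U by (simp add: orthogonal_matrix_def)
    qed simp
    also have "transpose U ** (N ** spectral_mat U a) ** U = M ** diag_mat a ** (transpose U ** U)"
      by (simp add: spectral_mat_def M_def matrix_mul_assoc)
    also have "\<dots> = M ** diag_mat a" using U by (simp add: orthogonal_matrix_def)
    also have "transpose U ** (spectral_mat U a ** N) ** U = (transpose U ** U) ** diag_mat a ** M"
      by (simp add: spectral_mat_def M_def matrix_mul_assoc)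
    also have "\<dots> = diag_mat a ** M" using U by (simp add: orthogonal_matrix_def)
    finally show ?thesis by (simp add: vec_eq_iff)
  qed
  have entry: "M $ i $ j * h j = h i * M $ i $ j" for i j
  proof (cases "M $ i $ j = 0")
    case False
    moreover have "M $ i $ j * d j = d i * M $ i $ j" using comm conv by blast
    ultimately have "d i = d j" by simp
    then show ?thesis using inj[of i j] by simp
  qed simp
  then show ?thesis using conv by blast
qed

section \<open>Square root, exponential, logarithm and pseudoinverse in an eigenbasis\<close>

lemma mat_sqrt_spec:
  fixes U :: "real^'n^'n"
  assumes U: "orthogonal_matrix U" and d: "\<And>i. 0 \<le> d i"
  shows "mat_sqrt (spectral_mat U d) = spectral_mat U (\<lambda>i. sqrt (d i))"
  unfolding mat_sqrt_def
proof (rule the_equality)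
  show "psd_mat (spectral_mat U (\<lambda>i. sqrt (d i))) \<and> spectral_mat U (\<lambda>i. sqrt (d i)) ** spectral_mat U (\<lambda>i. sqrt (d i)) = spectral_mat U d"
    using d by (simp add: psd_spec_iff[OF U] spec_mult[OF U])
next
  fix B assume B: "psd_mat B \<and> B ** B = spectral_mat U d"
  then obtain V e where V: "orthogonal_matrix V" and Be: "B = spectral_mat V e"
    using sym_mat_spectral[of B] unfolding psd_mat_def by blast
  have e: "\<And>i. 0 \<le> e i" using B Be psd_spec_iff[OF V] by simp
  have "spectral_mat V (\<lambda>i. (e i)\<^sup>2) = spectral_mat U (\<lambda>i. (sqrt (d i))\<^sup>2)"
    using B by (simp add: Be spec_mult[OF V] power2_eq_square d)
  moreover have "e i = sqrt (d j)" if "(e i)\<^sup>2 = (sqrt (d j))\<^sup>2" for i j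
    using that e d power2_eq_imp_eq real_sqrt_ge_zero by blast
  ultimately have "spectral_mat V e = spectral_mat U (\<lambda>i. sqrt (d i))"
    using spec_transfer[where g = "\<lambda>x. x\<^sup>2" and h = "\<lambda>x. x" and d = e and e = "\<lambda>i. sqrt (d i)", OF V U]
    by blast
  then show "B = spectral_mat U (\<lambda>i. sqrt (d i))" using Be by simp
qed

lemma psd_mat_sqrt_properties:
  assumes "psd_mat B"
  shows "psd_mat (mat_sqrt B)" "mat_sqrt B ** mat_sqrt B = B"
proof -
  obtain U d where U: "orthogonal_matrix U" and B: "B = spectral_mat U d"
    using sym_mat_spectral[of B] assms unfolding psd_mat_def by blast
  then have d: "\<And>i. 0 \<le> d i" using assms by (simp add: psd_spec_iff[OF U])
  show "psd_mat (mat_sqrt B)" "mat_sqrt B ** mat_sqrt B = B"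
    using d by (simp_all add: B mat_sqrt_spec[OF U] spec_mult[OF U] psd_spec_iff[OF U])
qed

lemma mat_sqrt_unique:
  assumes "psd_mat B" "B ** B = A"
  shows "mat_sqrt A = B"
proof -
  obtain U d where U: "orthogonal_matrix U" and B: "B = spectral_mat U d"
    using sym_mat_spectral[of B] assms unfolding psd_mat_def by blast
  then have d: "\<And>i. 0 \<le> d i" using assms by (simp add: psd_spec_iff[OF U])
  have "mat_sqrt A = mat_sqrt (spectral_mat U (\<lambda>i. d i * d i))" using assms(2) B spec_mult[OF U] by simp
  also have "\<dots> = B" using d by (simp add: mat_sqrt_spec[OF U] B)
  finally show ?thesis .
qed

lemma mat_pow_spec:
  assumes U: "orthogonal_matrix U"
  shows "mat_pow (spectral_mat U d) k = spectral_mat U (\<lambda>i. d i ^ k)"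
  by (induction k) (simp_all add: spec_one[OF U] spec_mult[OF U])

lemma mat_exp_spec:
  fixes U :: "real^'n^'n"
  assumes U: "orthogonal_matrix U"
  shows "mat_exp (spectral_mat U d) = spectral_mat U (\<lambda>i. exp (d i))"
proof -
  have "(\<lambda>n. \<Sum>k<n. d i ^ k / fact k) \<longlonglongrightarrow> exp (d i)" for i
    using exp_converges[of "d i"] by (simp add: sums_def divide_inverse mult.commute)
  then have "(\<lambda>n. spectral_mat U (\<lambda>i. \<Sum>k<n. d i ^ k / fact k)) \<longlonglongrightarrow> spectral_mat U (\<lambda>i. exp (d i))"
    by (intro vec_tendstoI) (simp add: spec_nth tendsto_intros)
  moreover have "(\<Sum>k<n. (1 / fact k) *\<^sub>R mat_pow (spectral_mat U d) k) = spectral_mat U (\<lambda>i. \<Sum>k<n. d i ^ k / fact k)" for n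
  proof (induction n)
    case 0
    show ?case by (simp add: vec_eq_iff spec_nth)
  next
    case (Suc n)
    then show ?case by (simp add: mat_pow_spec[OF U] spec_scaleR spec_add)
  qed
  ultimately have "(\<lambda>k. (1 / fact k) *\<^sub>R mat_pow (spectral_mat U d) k) sums spectral_mat U (\<lambda>i. exp (d i))"
    by (simp only: sums_def)
  then show ?thesis unfolding mat_exp_def by (rule sums_unique[symmetric])
qed

lemma mat_log_spec:
  fixes U :: "real^'n^'n"
  assumes U: "orthogonal_matrix U" and d: "\<And>i. 0 < d i"
  shows "mat_log (spectral_mat U d) = spectral_mat U (\<lambda>i. ln (d i))"
  unfolding mat_log_def
proof (rule the_equality)
  show "sym_mat (spectral_mat U (\<lambda>i. ln (d i))) \<and> mat_exp (spectral_mat U (\<lambda>i. ln (d i))) = spectral_mat U d"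
    using d by (simp add: mat_exp_spec[OF U])
next
  fix A assume A: "sym_mat A \<and> mat_exp A = spectral_mat U d"
  then obtain V e where V: "orthogonal_matrix V" and Ae: "A = spectral_mat V e"
    using sym_mat_spectral[of A] by blast
  have "spectral_mat V (\<lambda>i. exp (e i)) = spectral_mat U (\<lambda>i. exp (ln (d i)))"
    using A by (simp add: Ae mat_exp_spec[OF V] d)
  moreover have "e i = ln (d j)" if "exp (e i) = exp (ln (d j))" for i j
    using that by simp
  ultimately have "spectral_mat V e = spectral_mat U (\<lambda>i. ln (d i))"
    using spec_transfer[where g = exp and h = "\<lambda>x. x" and d = e and e = "\<lambda>i. ln (d i)", OF V U]
    by blast
  then show "A = spectral_mat U (\<lambda>i. ln (d i))" using Ae by simp
qed

text \<open>Penrose's argument: the symmetric idempotents \<open>B X\<close> and \<open>X B\<close> coincide with \<open>B Y\<close> and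
\<open>Y B\<close>.\<close>

lemma mat_pinv_unique:
  assumes X: "B ** X ** B = B" "X ** B ** X = X" "transpose (B ** X) = B ** X" "transpose (X ** B) = X ** B"
    and Y: "B ** Y ** B = B" "Y ** B ** Y = Y" "transpose (B ** Y) = B ** Y" "transpose (Y ** B) = Y ** B"
  shows "X = (Y :: real^'n^'n)"
proof -
  have 1: "B ** X = B ** Y"
  proof -
    have "B ** X = transpose (B ** Y ** B ** X)" using X Y by simp
    also have "\<dots> = transpose (B ** X) ** transpose (B ** Y)"
      by (simp add: matrix_transpose_mul matrix_mul_assoc)
    also have "\<dots> = (B ** X ** B) ** Y" using X(3) Y(3) by (simp add: matrix_mul_assoc)
    finally show ?thesis using X(1) by simp
  qed
  have 2: "X ** B = Y ** B"
  proof -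
    have "X ** B = transpose (X ** (B ** Y ** B))" using X Y by simp
    also have "\<dots> = transpose (Y ** B) ** transpose (X ** B)"
      by (simp add: matrix_transpose_mul matrix_mul_assoc)
    also have "\<dots> = Y ** (B ** X ** B)" using X(4) Y(4) by (simp add: matrix_mul_assoc)
    finally show ?thesis using X(1) by simp
  qed
  have "X = X ** (B ** X)" using X(2) by (simp add: matrix_mul_assoc)
  also have "\<dots> = (X ** B) ** Y" using 1 by (simp add: matrix_mul_assoc)
  also have "\<dots> = Y" using 2 Y(2) by simp
  finally show ?thesis .
qed

text \<open>The convention \<open>inverse 0 = 0\<close> on the reals is exactly what the pseudoinverse does to the zero
eigenvalues.\<close>

lemma mat_pinv_spec:
  fixes U :: "real^'n^'n"
  assumes U: "orthogonal_matrix U"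
  shows "mat_pinv (spectral_mat U d) = spectral_mat U (\<lambda>i. inverse (d i))"
  unfolding mat_pinv_def
proof (rule the_equality)
  have *: "x * inverse x * x = x" "inverse x * x * inverse x = inverse x" for x :: real
    by (cases "x = 0"; simp)+
  let ?X = "spectral_mat U (\<lambda>i. inverse (d i))"
  have 1: "spectral_mat U d ** ?X ** spectral_mat U d = spectral_mat U d" by (simp only: spec_mult[OF U] *)
  have 2: "?X ** spectral_mat U d ** ?X = ?X" by (simp only: spec_mult[OF U] *)
  have 3: "transpose (spectral_mat U d ** ?X) = spectral_mat U d ** ?X" by (simp only: spec_mult[OF U] transpose_spec)
  have 4: "transpose (?X ** spectral_mat U d) = ?X ** spectral_mat U d" by (simp only: spec_mult[OF U] transpose_spec)
  show "spectral_mat U d ** ?X ** spectral_mat U d = spectral_mat U d \<and> ?X ** spectral_mat U d ** ?X = ?X \<and>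
    transpose (spectral_mat U d ** ?X) = spectral_mat U d ** ?X \<and> transpose (?X ** spectral_mat U d) = ?X ** spectral_mat U d"
    using 1 2 3 4 by (intro conjI)
  show "X = ?X"
    if X: "spectral_mat U d ** X ** spectral_mat U d = spectral_mat U d \<and> X ** spectral_mat U d ** X = X \<and>
     transpose (spectral_mat U d ** X) = spectral_mat U d ** X \<and> transpose (X ** spectral_mat U d) = X ** spectral_mat U d" for X
    by (rule mat_pinv_unique[OF _ _ _ _ 1 2 3 4]) (use X in simp_all)
qed

lemma matrix_inv_eqI:
  fixes A B :: "real^'n^'n"
  assumes "A ** B = mat 1"
  shows "matrix_inv A = B"
proof -
  have BA: "B ** A = mat 1" using assms matrix_left_right_inverse by blast
  have "matrix_inv A ** A = mat 1"
    unfolding matrix_inv_def by (rule someI2[of _ B]) (use assms BA in auto)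
  then have "matrix_inv A = matrix_inv A ** (A ** B)" "matrix_inv A ** A ** B = B" using assms by auto
  then show ?thesis by (simp add: matrix_mul_assoc)
qed

lemma pd_mat_spectral:
  fixes A :: "real^'n^'n"
  assumes "pd_mat A"
  obtains U d where "orthogonal_matrix U" "A = spectral_mat U d" "\<And>i. 0 < d i"
proof -
  obtain U d where Ud: "orthogonal_matrix U" "A = spectral_mat U d"
    using sym_mat_spectral[of A] assms unfolding pd_mat_def by blast
  moreover have "0 < d i" for i using assms Ud pd_spec_iff by blast
  ultimately show thesis using that by blast
qed

lemma matrix_inv_spec:
  assumes U: "orthogonal_matrix U" and d: "\<And>i. d i \<noteq> 0"
  shows "matrix_inv (spectral_mat U d) = spectral_mat U (\<lambda>i. inverse (d i))"
  by (rule matrix_inv_eqI) (simp add: spec_mult[OF U] d spec_one[OF U])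

lemma pd_mat_sqrt: "pd_mat A \<Longrightarrow> pd_mat (mat_sqrt A)"
  by (erule pd_mat_spectral) (simp add: mat_sqrt_spec pd_spec_iff less_imp_le)

lemma pd_mat_inv: "pd_mat A \<Longrightarrow> pd_mat (matrix_inv A)"
  by (erule pd_mat_spectral) (simp add: matrix_inv_spec pd_spec_iff less_imp_neq[THEN not_sym])

lemma matrix_inv_pd:
  fixes A :: "real^'n^'n"
  assumes "pd_mat A"
  shows "A ** matrix_inv A = mat 1" "matrix_inv A ** A = mat 1"
proof -
  obtain U d where U: "orthogonal_matrix U" and A: "A = spectral_mat U d" and d: "\<And>i. 0 < d i"
    using pd_mat_spectral[OF assms] by blast
  have "d i \<noteq> 0" for i using d[of i] by simp
  then show "A ** matrix_inv A = mat 1" "matrix_inv A ** A = mat 1"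
    by (simp_all add: A matrix_inv_spec[OF U] spec_mult[OF U] spec_one[OF U])
qed

lemma pd_imp_psd: "pd_mat A \<Longrightarrow> psd_mat A"
  unfolding pd_mat_def psd_mat_def by (metis inner_zero_left less_eq_real_def)

lemma congruence_quad:
  "sym_mat B \<Longrightarrow> x \<bullet> ((B ** A ** B) *v x) = (B *v x) \<bullet> (A *v (B *v x))"
  by (simp add: matrix_vector_mul_assoc[symmetric] inner_sym_mat)

lemma sym_mat_congruence: "sym_mat A \<Longrightarrow> sym_mat B \<Longrightarrow> sym_mat (B ** A ** B)"
  by (simp add: sym_mat_def matrix_transpose_mul matrix_mul_assoc)

lemma pd_mat_congruence:
  fixes A B :: "real^'n^'n"
  assumes A: "pd_mat A" and B: "pd_mat B"
  shows "pd_mat (B ** A ** B)"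
  unfolding pd_mat_def
proof (intro conjI allI impI)
  show "sym_mat (B ** A ** B)" using A B by (simp add: pd_mat_def sym_mat_congruence)
  fix x :: "real^'n" assume "x \<noteq> 0"
  then have "B *v x \<noteq> 0" using B unfolding pd_mat_def by (metis inner_zero_right less_irrefl)
  then show "0 < x \<bullet> ((B ** A ** B) *v x)"
    using A B by (simp add: congruence_quad pd_mat_def)
qed

section \<open>The gradient flow of a quadratic potential\<close>

lemma coord_eq_inner: "(x v* U) $ i = x \<bullet> column i U" for x :: "real^'n"
  by (simp add: vector_matrix_mult_def column_def inner_vec_def mult.commute)

lemma coord_add: "((x + y) v* U) $ i = (x v* U) $ i + (y v* U) $ i" for x :: "real^'n"
  by (simp add: coord_eq_inner inner_add_left)

lemma coord_diff: "((x - y) v* U) $ i = (x v* U) $ i - (y v* U) $ i" for x :: "real^'n"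
  by (simp add: coord_eq_inner inner_diff_left)

text \<open>The integral of \<open>exp (a * s)\<close> over \<open>0 \<le> s \<le> t\<close>: the response at time \<open>t\<close> of the scalar
equation \<open>c' = a c + 1\<close> started at 0. At \<open>t = 1\<close> these are the eigenvalues of
\<open>K\<^sub>1(A)\<close>, the integral of \<open>exp (s A)\<close> over the unit interval.\<close>

definition duhamel :: "real \<Rightarrow> real \<Rightarrow> real" where
  "duhamel a t = (if a = 0 then t else (exp (a * t) - 1) / a)"

lemma duhamel_0 [simp]: "duhamel a 0 = 0"
  by (simp add: duhamel_def)

lemma duhamel_deriv: "(duhamel a has_real_derivative exp (a * t)) (at t)"
proof (cases "a = 0")
  case True
  then have "duhamel a = (\<lambda>t. t)" by (auto simp: duhamel_def)
  with True show ?thesis by simp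
next
  case False
  then have "duhamel a = (\<lambda>t. (exp (a * t) - 1) / a)" by (auto simp: duhamel_def)
  with False show ?thesis by (auto intro!: derivative_eq_intros)
qed

lemma duhamel_reflect: "exp (a * t) * duhamel (- a) t = duhamel a t"
  by (simp add: duhamel_def field_simps exp_minus)

lemma exp_eq_duhamel: "a * duhamel a t + 1 = exp (a * t)"
  by (simp add: duhamel_def)

lemma duhamel_pos: "0 < duhamel a 1"
  by (cases "a < 0") (auto simp: duhamel_def divide_neg_neg divide_pos_pos)

text \<open>Variation of constants: \<open>exp (- a s) * c s - b * duhamel (- a) s\<close> has derivative zero.\<close>

lemma linear_ode_unique:
  fixes c :: "real \<Rightarrow> real"
  assumes "\<And>s. (c has_real_derivative (a * c s + b)) (at s)"
  shows "c t = exp (a * t) * c 0 + duhamel a t * b"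
proof -
  have "((\<lambda>s. exp (- a * s) * c s - b * duhamel (- a) s) has_real_derivative 0) (at s)" for s
    by (auto intro!: derivative_eq_intros assms duhamel_deriv) (simp add: algebra_simps)
  then have "exp (- a * t) * c t - b * duhamel (- a) t = exp (- a * 0) * c 0 - b * duhamel (- a) 0"
    by (intro DERIV_isconst_all) blast
  then have "c t = exp (a * t) * (c 0 + b * duhamel (- a) t)"
    by (simp add: exp_minus field_simps)
  also have "\<dots> = exp (a * t) * c 0 + (exp (a * t) * duhamel (- a) t) * b"
    by (simp add: algebra_simps)
  finally show ?thesis by (simp only: duhamel_reflect)
qed

lemma spec_vec_sum: "spectral_mat U d *v x = (\<Sum>k\<in>UNIV. (d k * (x v* U) $ k) *\<^sub>R column k U)"
  for U :: "real^'n^'n"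
proof -
  have "spectral_mat U d *v x = (U ** diag_mat d) *v (x v* U)"
    by (simp add: spectral_mat_def matrix_vector_mul_assoc[symmetric])
  also have "\<dots> = (\<Sum>k\<in>UNIV. (d k * (x v* U) $ k) *\<^sub>R column k U)"
    by (simp add: vec_eq_iff matrix_vector_mult_def column_def mult_ac)
  finally show ?thesis .
qed

lemma spec_vec_has_vector_derivative:
  fixes U :: "real^'n^'n"
  assumes "\<And>i. ((\<lambda>t. h t i) has_real_derivative h' i) (at t)"
  shows "((\<lambda>t. spectral_mat U (h t) *v x) has_vector_derivative (spectral_mat U h' *v x)) (at t)"
proof -
  have "((\<lambda>t. (h t k * (x v* U) $ k) *\<^sub>R column k U) has_vector_derivative
      ((h' k * (x v* U) $ k) *\<^sub>R column k U)) (at t)" for k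
    using has_vector_derivative_scaleR[OF DERIV_cmult_right[OF assms[of k]] has_vector_derivative_const]
    by simp
  then show ?thesis unfolding spec_vec_sum by (intro has_vector_derivative_sum)
qed

lemma quadratic_gderiv:
  fixes A :: "real^'n^'n"
  assumes "sym_mat A"
  shows "GDERIV (\<lambda>x. (1/2) * (x \<bullet> (A *v x)) + b \<bullet> x) y :> A *v y + b"
proof -
  have A: "((\<lambda>x. A *v x) has_derivative (\<lambda>h. A *v h)) (at y)"
    by (rule bounded_linear_imp_has_derivative) simp
  have "((\<lambda>x. (1/2) * (x \<bullet> (A *v x)) + b \<bullet> x) has_derivative
    (\<lambda>h. (1/2) * (y \<bullet> (A *v h) + h \<bullet> (A *v y)) + b \<bullet> h)) (at y)"
    by (auto intro!: derivative_eq_intros A)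
  moreover have "y \<bullet> (A *v h) = h \<bullet> (A *v y)" for h
    using inner_sym_mat[OF assms, of y h] by (simp add: inner_commute)
  ultimately show ?thesis
    by (simp add: gderiv_def inner_add_right inner_commute[of b])
qed

lemma gderiv_unique:
  assumes "GDERIV f x :> v" "GDERIV f x :> w"
  shows "v = w"
proof -
  have "(\<lambda>h. h \<bullet> v) = (\<lambda>h. h \<bullet> w)"
    using assms unfolding gderiv_def by (rule has_derivative_unique)
  then have "h \<bullet> (v - w) = 0" for h by (simp add: inner_diff_right fun_eq_iff)
  from this[of "v - w"] show ?thesis by simp
qed

text \<open>The solution of \<open>y' = A y + b\<close> started at \<open>x\<close>, where \<open>A\<close> has eigenvalues \<open>a\<close> in the
basis \<open>U\<close>.\<close>

definition affine_flow :: "real^'n^'n \<Rightarrow> ('n \<Rightarrow> real) \<Rightarrow> real^'n \<Rightarrow> real \<Rightarrow> real^'n \<Rightarrow> real^'n" where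
  "affine_flow U a b t x = spectral_mat U (\<lambda>i. exp (a i * t)) *v x + spectral_mat U (\<lambda>i. duhamel (a i) t) *v b"

lemma coord_affine_flow:
  assumes "orthogonal_matrix U"
  shows "(affine_flow U a b t x v* U) $ i = exp (a i * t) * (x v* U) $ i + duhamel (a i) t * (b v* U) $ i"
  by (simp add: affine_flow_def coord_add coord_spec[OF assms])

text \<open>The gradient is unique where it exists, so any flow of \<open>f\<close> solves the affine equation; in
eigencoordinates this splits into scalar equations with unique solutions.\<close>

lemma gradient_flow_quadratic:
  fixes U :: "real^'n^'n"
  assumes U: "orthogonal_matrix U"
  shows "gradient_flow (\<lambda>x. (1/2) * (x \<bullet> (spectral_mat U a *v x)) + b \<bullet> x) = affine_flow U a b"
    (is "gradient_flow ?f = _")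
  unfolding gradient_flow_def
proof (rule the_equality)
  note gd = quadratic_gderiv[OF sym_mat_spec, of U a b]
  have deriv: "((\<lambda>s. affine_flow U a b s x) has_vector_derivative
      (spectral_mat U a *v affine_flow U a b t x + b)) (at t)" for t x
  proof -
    have "((\<lambda>s. affine_flow U a b s x) has_vector_derivative
        (spectral_mat U (\<lambda>i. exp (a i * t) * a i) *v x + spectral_mat U (\<lambda>i. exp (a i * t)) *v b)) (at t)"
      unfolding affine_flow_def
      by (intro has_vector_derivative_add spec_vec_has_vector_derivative duhamel_deriv)
        (auto intro!: derivative_eq_intros)
    moreover have "spectral_mat U (\<lambda>i. exp (a i * t) * a i) *v x + spectral_mat U (\<lambda>i. exp (a i * t)) *v b
      = spectral_mat U a *v affine_flow U a b t x + b"
    proof (rule coord_eqI[OF U])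
      fix i
      have "exp (a i * t) * (b v* U) $ i = (a i * duhamel (a i) t + 1) * (b v* U) $ i"
        by (simp only: exp_eq_duhamel)
      then show "((spectral_mat U (\<lambda>i. exp (a i * t) * a i) *v x + spectral_mat U (\<lambda>i. exp (a i * t)) *v b) v* U) $ i
        = ((spectral_mat U a *v affine_flow U a b t x + b) v* U) $ i"
        by (simp add: coord_add coord_spec[OF U] coord_affine_flow[OF U] algebra_simps)
    qed
    ultimately show ?thesis by simp
  qed
  have "affine_flow U a b 0 x = x" for x
    by (simp add: affine_flow_def spec_one[OF U]) (simp add: spec_vec_sum)
  then show "is_gradient_flow ?f (affine_flow U a b)"
    unfolding is_gradient_flow_def using gd deriv by blast
next
  fix \<phi> assume \<phi>: "is_gradient_flow ?f \<phi>"
  have ode: "((\<lambda>s. \<phi> s x) has_vector_derivative (spectral_mat U a *v \<phi> t x + b)) (at t)" for t x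
    using \<phi> gderiv_unique[OF quadratic_gderiv[OF sym_mat_spec, of U a b "\<phi> t x"]]
    unfolding is_gradient_flow_def by metis
  show "\<phi> = affine_flow U a b"
  proof (intro ext)
    fix t x
    show "\<phi> t x = affine_flow U a b t x"
    proof (rule coord_eqI[OF U])
      fix i
      have "((\<lambda>s. (\<phi> s x v* U) $ i) has_real_derivative (a i * (\<phi> s x v* U) $ i + (b v* U) $ i)) (at s)" for s
      proof -
        have "((\<lambda>s. \<phi> s x \<bullet> column i U) has_vector_derivative
           ((spectral_mat U a *v \<phi> s x + b) \<bullet> column i U)) (at s)"
          by (rule bounded_linear.has_vector_derivative[OF bounded_linear_inner_left ode])
        moreover have "(spectral_mat U a *v \<phi> s x + b) \<bullet> column i U = a i * (\<phi> s x v* U) $ i + (b v* U) $ i"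
          by (simp only: coord_eq_inner[symmetric] coord_add coord_spec[OF U])
        ultimately show ?thesis
          by (simp only: coord_eq_inner[symmetric] has_real_derivative_iff_has_vector_derivative)
      qed
      from linear_ode_unique[OF this, of t]
      show "(\<phi> t x v* U) $ i = (affine_flow U a b t x v* U) $ i"
        using \<phi> by (simp add: is_gradient_flow_def coord_affine_flow[OF U])
    qed
  qed
qed

section \<open>Time average of the potential along the flow\<close>

text \<open>The integral of \<open>exp (2 * a * s)\<close> over \<open>t \<le> s \<le> 1\<close>. Along a gradient flow the potential
grows at the rate of its squared gradient, and the gradient component of eigenvalue \<open>a\<close> grows like
\<open>exp (a * s)\<close>, so this is the factor by which the initial squared component enters the increase of
the potential between the times \<open>t\<close> and 1.\<close>

definition drop_rate :: "real \<Rightarrow> real \<Rightarrow> real" where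
  "drop_rate a t = (if a = 0 then 1 - t else (exp (2 * a) - exp (2 * a * t)) / (2 * a))"

text \<open>The integral of \<open>drop_rate a\<close> over the unit interval, that is of \<open>s * exp (2 * a * s)\<close>.\<close>

definition wkl_weight :: "real \<Rightarrow> real" where
  "wkl_weight a = (if a = 0 then 1/2 else (exp (2 * a) * (2 * a - 1) + 1) / (4 * a\<^sup>2))"

lemma potential_coord:
  fixes U :: "real^'n^'n"
  assumes U: "orthogonal_matrix U"
  shows "(1/2) * (x \<bullet> (spectral_mat U a *v x)) + b \<bullet> x
    = (\<Sum>i\<in>UNIV. (1/2) * a i * ((x v* U) $ i)\<^sup>2 + (b v* U) $ i * (x v* U) $ i)"
  by (simp add: quad_spec[OF U] inner_coord[OF U, of b] sum.distrib sum_distrib_left mult_ac)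

lemma scalar_drop:
  fixes a x b t :: real
  defines "c \<equiv> \<lambda>t. exp (a * t) * x + duhamel a t * b"
  shows "((1/2) * a * (c 1)\<^sup>2 + b * c 1) - ((1/2) * a * (c t)\<^sup>2 + b * c t) = drop_rate a t * (a * x + b)\<^sup>2"
proof (cases "a = 0")
  case True
  then show ?thesis by (simp add: c_def drop_rate_def duhamel_def power2_eq_square algebra_simps)
next
  case False
  \<comment> \<open>Completing the square expresses the potential by the gradient component \<open>a * c s + b\<close>.\<close>
  have sq: "(1/2) * a * (c s)\<^sup>2 + b * c s = (exp (2 * a * s) * (a * x + b)\<^sup>2 - b\<^sup>2) / (2 * a)" for s
  proof -
    have 1: "a * c s + b = exp (a * s) * (a * x + b)"
      using exp_eq_duhamel[of a s] False by (simp add: c_def duhamel_def field_simps)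
    have "(1/2) * a * (c s)\<^sup>2 + b * c s = ((a * c s + b)\<^sup>2 - b\<^sup>2) / (2 * a)"
      using False by (simp add: field_simps power2_eq_square)
    also have "(a * c s + b)\<^sup>2 = exp (2 * a * s) * (a * x + b)\<^sup>2"
      by (simp add: 1 power_mult_distrib exp_double[symmetric] mult.assoc)
    finally show ?thesis .
  qed
  show ?thesis unfolding sq using False by (simp add: drop_rate_def field_simps)
qed

lemma drop_rate_integral:
  "(LBINT t:{0..1}. (\<Sum>i\<in>I. drop_rate (a i) t * h i)) = (\<Sum>i\<in>I. wkl_weight (a i) * h i)"
proof -
  define P where "P a t = (if a = 0 then t - t\<^sup>2 / 2
    else (exp (2 * a) * t - exp (2 * a * t) / (2 * a)) / (2 * a))" for a t :: real
  have P: "(P a has_real_derivative drop_rate a t) (at t)" for a t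
  proof (cases "a = 0")
    case True
    then have "P a = (\<lambda>t. t - t\<^sup>2 / 2)" by (auto simp: P_def)
    with True show ?thesis by (auto intro!: derivative_eq_intros simp: drop_rate_def)
  next
    case False
    then have "P a = (\<lambda>t. (exp (2 * a) * t - exp (2 * a * t) / (2 * a)) / (2 * a))" by (auto simp: P_def)
    with False show ?thesis
      by (auto intro!: derivative_eq_intros simp: drop_rate_def) (simp add: field_simps)
  qed
  have cont: "isCont (drop_rate a) t" for a t
  proof (cases "a = 0")
    case True
    then have "drop_rate a = (\<lambda>t. 1 - t)" by (auto simp: drop_rate_def)
    then show ?thesis by simp
  next
    case False
    then have "drop_rate a = (\<lambda>t. (exp (2 * a) - exp (2 * a * t)) / (2 * a))" by (auto simp: drop_rate_def)
    with False show ?thesis by (auto intro!: continuous_intros)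
  qed
  have PP: "P a 1 - P a 0 = wkl_weight a" for a
    by (simp add: P_def wkl_weight_def field_simps power2_eq_square)
  have "(LBINT t:{0..1}. (\<Sum>i\<in>I. drop_rate (a i) t * h i))
    = (\<integral>t. (\<Sum>i\<in>I. drop_rate (a i) t * h i) * indicator {0..1} t \<partial>lborel)"
    by (simp add: set_lebesgue_integral_def mult.commute)
  also have "\<dots> = (\<Sum>i\<in>I. P (a i) 1 * h i) - (\<Sum>i\<in>I. P (a i) 0 * h i)"
    by (rule integral_FTC_Icc_real)
      (auto intro!: DERIV_sum DERIV_cmult_right P continuous_intros cont)
  also have "\<dots> = (\<Sum>i\<in>I. wkl_weight (a i) * h i)"
    by (simp add: sum_subtractf[symmetric] PP left_diff_distrib[symmetric])
  finally show ?thesis .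
qed

lemma potential_drop_integral:
  fixes U :: "real^'n^'n" and a :: "'n \<Rightarrow> real" and b :: "real^'n"
  assumes U: "orthogonal_matrix U"
  defines "f \<equiv> \<lambda>x. (1/2) * (x \<bullet> (spectral_mat U a *v x)) + b \<bullet> x"
  shows "(LBINT t:{0..1}. f (affine_flow U a b 1 x) - f (affine_flow U a b t x))
    = (\<Sum>i\<in>UNIV. wkl_weight (a i) * (a i * (x v* U) $ i + (b v* U) $ i)\<^sup>2)"
proof -
  have "f (affine_flow U a b 1 x) - f (affine_flow U a b t x)
    = (\<Sum>i\<in>UNIV. drop_rate (a i) t * (a i * (x v* U) $ i + (b v* U) $ i)\<^sup>2)" for t
    unfolding f_def potential_coord[OF U] coord_affine_flow[OF U] sum_subtractf[symmetric]
    by (intro sum.cong refl scalar_drop)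
  then show ?thesis by (simp only: drop_rate_integral)
qed

text \<open>This is where the function \<open>r\<^sup>2 log r\<^sup>2 - r\<^sup>2 + 1\<close> of the eigenvalue \<open>r = exp a\<close> of the
transport matrix comes from.\<close>

lemma wkl_weight_eq:
  "4 * (a\<^sup>2 * wkl_weight a) = ln ((exp a)\<^sup>2) * (exp a)\<^sup>2 - (exp a)\<^sup>2 + 1"
proof -
  have "4 * (a\<^sup>2 * wkl_weight a) = exp (2 * a) * (2 * a - 1) + 1"
    by (simp add: wkl_weight_def)
  also have "\<dots> = ln ((exp a)\<^sup>2) * (exp a)\<^sup>2 - (exp a)\<^sup>2 + 1"
    by (simp add: exp_double[symmetric] algebra_simps)
  finally show ?thesis .
qed

section \<open>Linear images of Lebesgue measure\<close>

lemma borel_measurable_matrix_vec [measurable]: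
  fixes A :: "real^'n^'m"
  shows "(\<lambda>x. A *v x) \<in> borel_measurable borel"
  by (intro borel_measurable_continuous_onI linear_continuous_on) simp

lemma nn_integral_lborel_shift:
  fixes g :: "'a::euclidean_space \<Rightarrow> ennreal"
  assumes "g \<in> borel_measurable borel"
  shows "(\<integral>\<^sup>+x. g (c + x) \<partial>lborel) = (\<integral>\<^sup>+x. g x \<partial>lborel)"
proof -
  have "(\<integral>\<^sup>+x. g x \<partial>lborel) = (\<integral>\<^sup>+x. g x \<partial>distr lborel borel ((+) c))"
    by (simp add: lborel_distr_plus)
  also have "\<dots> = (\<integral>\<^sup>+x. g (c + x) \<partial>lborel)"
    using assms by (intro nn_integral_distr) auto
  finally show ?thesis by simp
qed

lemma nn_integral_lborel_reflect:
  fixes g :: "'a::euclidean_space \<Rightarrow> ennreal"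
  assumes g: "g \<in> borel_measurable borel"
  shows "(\<integral>\<^sup>+x. g (c - x) \<partial>lborel) = (\<integral>\<^sup>+x. g x \<partial>lborel)"
proof -
  have "lborel = distr lborel borel (\<lambda>x::'a. c + (-1) *\<^sub>R x)"
    using lborel_affine[of "-1" c] by (simp add: density_1 one_ennreal_def[symmetric])
  then have "(\<integral>\<^sup>+x. g x \<partial>lborel) = (\<integral>\<^sup>+x. g x \<partial>distr lborel borel (\<lambda>x. c + (-1) *\<^sub>R x))"
    by simp
  also have "\<dots> = (\<integral>\<^sup>+x. g (c - x) \<partial>lborel)"
    using g by (subst nn_integral_distr) auto
  finally show ?thesis by simp
qed

text \<open>Uniqueness of translation invariant measures: for the image \<open>\<mu>\<close> of Lebesgue measure \<open>\<lambda>\<close> and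
the unit ball \<open>B\<close>, Fubini and translation invariance give \<open>\<lambda>(B) \<mu>(A) = \<lambda>(A) \<mu>(B)\<close>, and \<open>\<mu>(B) = \<lambda>(B)\<close>
because \<open>U\<close> preserves \<open>B\<close>.\<close>

lemma lborel_distr_orthogonal:
  fixes U :: "real^'n^'n"
  assumes U: "orthogonal_matrix U"
  shows "distr lborel borel (\<lambda>x. U *v x) = lborel"
proof (rule measure_eqI)
  show "sets (distr lborel borel (\<lambda>x. U *v x)) = sets lborel" by simp
  fix A assume "A \<in> sets (distr lborel borel (\<lambda>x. U *v x))"
  then have A [measurable]: "A \<in> sets borel" by simp
  define B where "B = ball (0 :: real^'n) 1"
  have B [measurable]: "B \<in> sets borel" by (simp add: B_def)
  have UU: "U *v (transpose U *v y) = y" for y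
    using U by (simp only: orthogonal_matrix_def matrix_vector_mul_assoc matrix_vector_mul_lid)
  have iso: "norm (U *v x) = norm x" for x
    using U orthogonal_transformation_matrix[of "(*v) U"] orthogonal_transformation_norm by force
  have "emeasure lborel B * emeasure (distr lborel borel (\<lambda>x. U *v x)) A
    = (\<integral>\<^sup>+y. (\<integral>\<^sup>+x. indicator A (U *v x) * indicator B y \<partial>lborel) \<partial>lborel)"
  proof -
    have "emeasure (distr lborel borel (\<lambda>x. U *v x)) A = (\<integral>\<^sup>+x. indicator A (U *v x) \<partial>lborel)"
    proof -
      have "emeasure (distr lborel borel (\<lambda>x. U *v x)) A
        = (\<integral>\<^sup>+x. indicator A x \<partial>distr lborel borel (\<lambda>x. U *v x))" by simp
      also have "\<dots> = (\<integral>\<^sup>+x. indicator A (U *v x) \<partial>lborel)"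
        by (rule nn_integral_distr) measurable
      finally show ?thesis .
    qed
    moreover have "(\<integral>\<^sup>+x. indicator A (U *v x) * indicator B y \<partial>lborel)
      = (\<integral>\<^sup>+x. indicator A (U *v x) \<partial>lborel) * indicator B y" for y
      by (rule nn_integral_multc) measurable
    ultimately show ?thesis
      by (simp add: nn_integral_cmult_indicator mult.commute[of "emeasure lborel _"])
  qed
  also have "\<dots> = (\<integral>\<^sup>+y. (\<integral>\<^sup>+x. indicator A (U *v x + y) * indicator B y \<partial>lborel) \<partial>lborel)"
  proof (rule nn_integral_cong)
    fix y
    have "(\<integral>\<^sup>+x. indicator A (U *v x) * indicator B y \<partial>lborel)
      = (\<integral>\<^sup>+x. indicator A (U *v (transpose U *v y + x)) * indicator B y \<partial>lborel)"
      by (rule nn_integral_lborel_shift[symmetric]) measurable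
    then show "(\<integral>\<^sup>+x. indicator A (U *v x) * indicator B y \<partial>lborel)
      = (\<integral>\<^sup>+x. indicator A (U *v x + y) * indicator B y \<partial>lborel)"
      by (simp only: matrix_vector_right_distrib UU add.commute)
  qed
  also have "\<dots> = (\<integral>\<^sup>+x. (\<integral>\<^sup>+y. indicator A (U *v x + y) * indicator B y \<partial>lborel) \<partial>lborel)"
    by (rule lborel_pair.Fubini') measurable
  also have "\<dots> = (\<integral>\<^sup>+x. (\<integral>\<^sup>+y. indicator A y * indicator B (y - U *v x) \<partial>lborel) \<partial>lborel)"
  proof (rule nn_integral_cong)
    fix x :: "real^'n"
    show "(\<integral>\<^sup>+y. indicator A (U *v x + y) * indicator B y \<partial>lborel)
      = (\<integral>\<^sup>+y. indicator A y * indicator B (y - U *v x) \<partial>lborel)"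
      using nn_integral_lborel_shift[of "\<lambda>y. indicator A y * indicator B (y - U *v x)" "U *v x"]
      by simp
  qed
  also have "\<dots> = (\<integral>\<^sup>+y. (\<integral>\<^sup>+x. indicator A y * indicator B (y - U *v x) \<partial>lborel) \<partial>lborel)"
    by (rule lborel_pair.Fubini'[symmetric]) measurable
  also have "\<dots> = (\<integral>\<^sup>+y. indicator A y * emeasure lborel B \<partial>lborel)"
  proof (rule nn_integral_cong)
    fix y :: "real^'n"
    have "(indicator B (y - U *v x) :: ennreal) = indicator B (transpose U *v y - x)" for x
    proof -
      have "y - U *v x = U *v (transpose U *v y - x)"
        by (simp only: matrix_vector_mult_diff_distrib UU)
      then have "norm (y - U *v x) = norm (transpose U *v y - x)" by (simp only: iso)
      then show ?thesis by (simp only: indicator_def B_def mem_ball dist_0_norm)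
    qed
    then have "(\<integral>\<^sup>+x. indicator A y * indicator B (y - U *v x) \<partial>lborel)
      = indicator A y * (\<integral>\<^sup>+x. indicator B (transpose U *v y - x) \<partial>lborel)"
      by (simp add: nn_integral_cmult)
    also have "(\<integral>\<^sup>+x. indicator B (transpose U *v y - x) \<partial>lborel) = emeasure lborel B"
      by (subst nn_integral_lborel_reflect) auto
    finally show "(\<integral>\<^sup>+x. indicator A y * indicator B (y - U *v x) \<partial>lborel)
      = indicator A y * emeasure lborel B" .
  qed
  also have "\<dots> = emeasure lborel B * emeasure lborel A"
    by (simp add: nn_integral_multc mult.commute)
  finally have "emeasure lborel B * emeasure (distr lborel borel (\<lambda>x. U *v x)) A
    = emeasure lborel B * emeasure lborel A" .
  moreover have "emeasure lborel B \<noteq> 0"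
    using open_not_negligible[of B] by (auto simp: B_def negligible_iff_emeasure0)
  moreover have "emeasure lborel B \<noteq> top"
    using emeasure_bounded_finite[of B] by (simp add: B_def)
  ultimately show "emeasure (distr lborel borel (\<lambda>x. U *v x)) A = emeasure lborel A"
    by (simp add: ennreal_mult_cancel_left)
qed

lemma det_spec:
  assumes U: "orthogonal_matrix U"
  shows "det (spectral_mat U d) = (\<Prod>i\<in>UNIV. d i)"
proof -
  have "det (spectral_mat U d) = det U * det (transpose U) * det (diag_mat d)"
    by (simp add: spectral_mat_def det_mul)
  also have "det U * det (transpose U) = 1"
    using U by (simp only: orthogonal_matrix_def det_mul[symmetric] det_I)
  also have "det (diag_mat d) = (\<Prod>i\<in>UNIV. d i)"
    by (subst det_diagonal) (simp_all add: diag_mat_nth)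
  finally show ?thesis by simp
qed

text \<open>Split the map into an orthogonal map, a scaling of the coordinate axes, an orthogonal map and
a translation; only the scaling changes the measure.\<close>

lemma lborel_distr_spec:
  fixes U :: "real^'n^'n"
  assumes U: "orthogonal_matrix U" and d: "\<And>i. d i \<noteq> 0"
  shows "density (distr lborel borel (\<lambda>x. spectral_mat U d *v x + c)) (\<lambda>_. \<bar>det (spectral_mat U d)\<bar>) = lborel"
proof -
  \<comment> \<open>The factor of a basis vector is that of its coordinate; distinct coordinates have distinct axes.\<close>
  define e where "e b = d (THE i. b = axis i 1)" for b :: "real^'n"
  have e: "e (axis i 1) = d i" for i
    by (simp add: e_def axis_eq_axis)
  have Basis: "Basis = range (\<lambda>i::'n. axis i (1::real))"
    by (auto simp: Basis_vec_def)
  have inj: "inj (\<lambda>i::'n. axis i (1::real))"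
    by (auto simp: inj_def axis_eq_axis)
  have D: "(\<Sum>j\<in>Basis. (e j * (x \<bullet> j)) *\<^sub>R j) = diag_mat d *v x" for x
  proof -
    have "(\<Sum>j\<in>Basis. (e j * (x \<bullet> j)) *\<^sub>R j) = (\<Sum>i\<in>UNIV. (d i * x $ i) *\<^sub>R axis i 1)"
      unfolding Basis sum.reindex[OF inj] by (simp add: e inner_axis)
    also have "\<dots> = diag_mat d *v x"
      by (simp add: vec_eq_iff axis_def if_distrib cong: if_cong)
    finally show ?thesis .
  qed
  have "(\<Prod>j\<in>Basis. \<bar>e j\<bar>) = (\<Prod>i\<in>UNIV. \<bar>d i\<bar>)"
    unfolding Basis prod.reindex[OF inj] by (simp add: e)
  then have det: "(\<Prod>j\<in>Basis. \<bar>e j\<bar>) = \<bar>det (spectral_mat U d)\<bar>"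
    by (simp add: det_spec[OF U] abs_prod)
  have diag: "density (distr lborel borel (\<lambda>x. diag_mat d *v x)) (\<lambda>_. \<bar>det (spectral_mat U d)\<bar>) = lborel"
  proof -
    have "e j \<noteq> 0" if "j \<in> Basis" for j using that d by (auto simp: Basis e)
    from lborel_affine_euclidean[of e 0, OF this] show ?thesis
      unfolding D det by simp
  qed
  have comp: "distr lborel borel (\<lambda>x. spectral_mat U d *v x + c)
    = distr (distr lborel borel (\<lambda>x. diag_mat d *v x)) borel (\<lambda>x. c + U *v x)"
  proof -
    have "distr (distr lborel borel (\<lambda>x. diag_mat d *v x)) borel (\<lambda>x. c + U *v x)
      = distr (distr (distr lborel borel (\<lambda>x. transpose U *v x)) borel (\<lambda>x. diag_mat d *v x)) borel (\<lambda>x. c + U *v x)"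
      using U by (subst lborel_distr_orthogonal) simp_all
    also have "\<dots> = distr lborel borel (\<lambda>x. c + U *v (diag_mat d *v (transpose U *v x)))"
      by (subst distr_distr, measurable)+ (simp add: comp_def)
    finally show ?thesis by (simp only: spectral_mat_def matrix_vector_mul_assoc add.commute matrix_mul_assoc)
  qed
  have "density (distr lborel borel (\<lambda>x. spectral_mat U d *v x + c)) (\<lambda>_. \<bar>det (spectral_mat U d)\<bar>)
    = distr (density (distr lborel borel (\<lambda>x. diag_mat d *v x)) (\<lambda>_. \<bar>det (spectral_mat U d)\<bar>)) borel (\<lambda>x. c + U *v x)"
    unfolding comp by (rule density_distr) measurable
  also have "\<dots> = distr (distr lborel borel (\<lambda>x. U *v x)) borel ((+) c)"
    unfolding diag by (subst distr_distr) (simp_all add: comp_def)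
  also have "\<dots> = lborel"
    by (simp only: lborel_distr_orthogonal[OF U] lborel_distr_plus)
  finally show ?thesis .
qed

section \<open>Gaussian measures: affine images and second moments\<close>

definition gauss_density :: "real^'n \<Rightarrow> real^'n^'n \<Rightarrow> real^'n \<Rightarrow> real" where
  "gauss_density m S x = exp (- ((x - m) \<bullet> (matrix_inv S *v (x - m))) / 2) / sqrt ((2 * pi) ^ CARD('n) * det S)"

lemma gaussian_eq_density: "gaussian m S = density lborel (\<lambda>x. ennreal (gauss_density m S x))"
  by (simp add: gaussian_def gauss_density_def)

lemma borel_measurable_gauss_density [measurable]: "gauss_density m S \<in> borel_measurable borel"
proof -
  have "continuous_on UNIV (\<lambda>x. gauss_density m S x)"
    unfolding gauss_density_def divide_inverse
    by (intro continuous_intros linear_continuous_on_compose[of _ "\<lambda>x. x - m" "(*v) (matrix_inv S)"]) auto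
  then show ?thesis by (intro borel_measurable_continuous_onI) simp
qed

lemma sets_gaussian [simp, measurable_cong]: "sets (gaussian m S) = sets borel"
  by (simp add: gaussian_def)

lemma space_gaussian [simp]: "space (gaussian m S) = UNIV"
  by (simp add: gaussian_def)

text \<open>Change of variables: in the new coordinates the quadratic form of the density is the old one,
and the two Jacobian factors \<open>det L\<close> from \<open>det (L S L) = (det L)\<^sup>2 det S\<close> and from Lebesgue measure
cancel.\<close>

lemma gaussian_affine:
  fixes L S :: "real^'n^'n"
  assumes L: "pd_mat L" and S: "pd_mat S"
  shows "distr (gaussian m S) borel (\<lambda>x. L *v x + c) = gaussian (L *v m + c) (L ** S ** L)"
proof -
  let ?T = "\<lambda>x. L *v x + c"
  let ?h = "gauss_density (L *v m + c) (L ** S ** L)"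
  obtain U d where U: "orthogonal_matrix U" and Ld: "L = spectral_mat U d" and d: "\<And>i. 0 < d i"
    using pd_mat_spectral[OF L] by blast
  have lb: "density (distr lborel borel ?T) (\<lambda>_. \<bar>det L\<bar>) = lborel"
    unfolding Ld by (rule lborel_distr_spec[OF U]) (use d in \<open>simp add: less_imp_neq[THEN not_sym]\<close>)
  have Linv: "L ** matrix_inv L = mat 1" "matrix_inv L ** L = mat 1"
    using matrix_inv_pd[OF L] by auto
  have Sinv: "S ** matrix_inv S = mat 1" using matrix_inv_pd[OF S] by auto
  have inv: "matrix_inv (L ** S ** L) = matrix_inv L ** matrix_inv S ** matrix_inv L"
  proof (rule matrix_inv_eqI)
    have "L ** S ** L ** (matrix_inv L ** matrix_inv S ** matrix_inv L)
      = L ** S ** (L ** matrix_inv L) ** matrix_inv S ** matrix_inv L" by (simp only: matrix_mul_assoc)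
    also have "\<dots> = L ** (S ** matrix_inv S) ** matrix_inv L" by (simp add: Linv matrix_mul_assoc)
    finally show "L ** S ** L ** (matrix_inv L ** matrix_inv S ** matrix_inv L) = mat 1"
      by (simp add: Sinv Linv)
  qed
  have symLi: "sym_mat (matrix_inv L)" using pd_mat_inv[OF L] by (simp add: pd_mat_def)
  have detL: "det L > 0" unfolding Ld det_spec[OF U] by (intro prod_pos) (simp add: d)
  have h: "det L * ?h (?T x) = gauss_density m S x" for x
  proof -
    have diff: "?T x - (L *v m + c) = L *v (x - m)" by (simp add: matrix_vector_mult_diff_distrib)
    have "(L *v (x - m)) \<bullet> (matrix_inv (L ** S ** L) *v (L *v (x - m)))
      = (matrix_inv L *v (L *v (x - m))) \<bullet> (matrix_inv S *v (matrix_inv L *v (L *v (x - m))))"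
      unfolding inv by (rule congruence_quad[OF symLi])
    also have "matrix_inv L *v (L *v (x - m)) = x - m"
      by (simp only: matrix_vector_mul_assoc Linv matrix_vector_mul_lid)
    finally have q: "(L *v (x - m)) \<bullet> (matrix_inv (L ** S ** L) *v (L *v (x - m))) = (x - m) \<bullet> (matrix_inv S *v (x - m))" .
    have "sqrt ((2 * pi) ^ CARD('n) * det (L ** S ** L)) = det L * sqrt ((2 * pi) ^ CARD('n) * det S)"
      using detL by (simp add: det_mul real_sqrt_mult)
    then show ?thesis using detL unfolding gauss_density_def diff q by simp
  qed
  have [measurable]: "?T \<in> borel_measurable borel" by measurable
  have "gaussian (L *v m + c) (L ** S ** L) = density (density (distr lborel borel ?T) (\<lambda>_. \<bar>det L\<bar>)) (\<lambda>x. ennreal (?h x))"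
    unfolding lb by (rule gaussian_eq_density)
  also have "\<dots> = density (distr lborel borel ?T) (\<lambda>x. ennreal \<bar>det L\<bar> * ennreal (?h x))"
    by (rule density_density_eq) measurable
  also have "\<dots> = distr (density lborel (\<lambda>x. ennreal \<bar>det L\<bar> * ennreal (?h (?T x)))) borel ?T"
    by (rule density_distr) measurable
  also have "(\<lambda>x. ennreal \<bar>det L\<bar> * ennreal (?h (?T x))) = (\<lambda>x. ennreal (gauss_density m S x))"
    using detL by (simp add: ennreal_mult'[symmetric] h)
  finally show ?thesis by (simp add: gaussian_eq_density)
qed

text \<open>Fubini for product functions, through the description of Lebesgue measure as a product
measure.\<close>

lemma has_bochner_integral_lborel_prod:
  fixes f :: "'n::finite \<Rightarrow> real \<Rightarrow> real"
  assumes "\<And>i. integrable lborel (f i)"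
  shows "has_bochner_integral lborel (\<lambda>x::real^'n. \<Prod>i\<in>UNIV. f i (x $ i)) (\<Prod>i\<in>UNIV. integral\<^sup>L lborel (f i))"
proof -
  interpret product_sigma_finite "\<lambda>_::real^'n. lborel :: real measure" ..
  define g where "g b = f (THE i. b = axis i 1)" for b :: "real^'n"
  have g: "g (axis i 1) = f i" for i
    by (simp add: g_def axis_eq_axis)
  have Basis: "Basis = range (\<lambda>i::'n. axis i (1::real))"
    by (auto simp: Basis_vec_def)
  have inj: "inj (\<lambda>i::'n. axis i (1::real))"
    by (auto simp: inj_def axis_eq_axis)
  have reindex: "(\<Prod>b\<in>Basis. F b) = (\<Prod>i\<in>UNIV. F (axis i 1))" for F :: "real^'n \<Rightarrow> real"
    unfolding Basis prod.reindex[OF inj] by simp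
  have int: "integrable lborel (g b)" if "b \<in> Basis" for b
    using that assms by (auto simp: Basis g)
  have [measurable]: "f i \<in> borel_measurable borel" for i
    using borel_measurable_integrable[OF assms[of i]] by simp
  have comp: "(\<Sum>b\<in>Basis. y b *\<^sub>R b) $ i = y (axis i 1)" for y and i :: 'n
  proof -
    have "(\<Sum>b\<in>Basis. y b *\<^sub>R b) $ i = (\<Sum>b\<in>Basis. y b *\<^sub>R b) \<bullet> axis i 1" by (simp add: inner_axis)
    also have "\<dots> = y (axis i 1)" by (rule inner_sum_left_Basis) (auto simp: Basis)
    finally show ?thesis .
  qed
  have "has_bochner_integral (\<Pi>\<^sub>M b\<in>Basis. lborel) (\<lambda>y. \<Prod>b\<in>Basis. g b (y b)) (\<Prod>b\<in>Basis. integral\<^sup>L lborel (g b))"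
    unfolding has_bochner_integral_iff
    using product_integrable_prod[of Basis g] product_integral_prod[of Basis g] int by simp
  then have *: "has_bochner_integral (\<Pi>\<^sub>M b\<in>Basis. lborel)
      (\<lambda>y. \<Prod>i\<in>UNIV. f i ((\<Sum>b\<in>Basis. y b *\<^sub>R b) $ i)) (\<Prod>i\<in>UNIV. integral\<^sup>L lborel (f i))"
    by (simp only: reindex g comp)
  show ?thesis
    by (subst lborel_eq, rule has_bochner_integral_distr[where f = "\<lambda>x. \<Prod>i\<in>UNIV. f i (x $ i)", OF _ _ *]) measurable
qed

lemma std_gaussian_moment:
  fixes e :: "'n::finite \<Rightarrow> nat"
  shows "has_bochner_integral (gaussian 0 (mat 1)) (\<lambda>z::real^'n. \<Prod>i\<in>UNIV. (z $ i) ^ e i)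
    (\<Prod>i\<in>UNIV. \<integral>y. std_normal_density y * y ^ e i \<partial>lborel)"
proof -
  have inv: "matrix_inv (mat 1 :: real^'n^'n) = mat 1" by (rule matrix_inv_eqI) simp
  have dens: "gauss_density 0 (mat 1) z = (\<Prod>i\<in>UNIV. std_normal_density (z $ i))" for z :: "real^'n"
  proof -
    have "(\<Prod>i\<in>UNIV. std_normal_density (z $ i))
      = (1 / sqrt (2 * pi)) ^ CARD('n) * exp (\<Sum>i\<in>UNIV. - (z $ i)\<^sup>2 / 2)"
      by (simp add: std_normal_density_def prod.distrib exp_sum prod_dividef power_one_over)
    also have "(\<Sum>i\<in>UNIV. - (z $ i)\<^sup>2 / 2) = - (z \<bullet> z) / 2"
      by (simp add: inner_vec_def sum_negf sum_divide_distrib[symmetric] power2_eq_square)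
    finally show ?thesis
      by (simp only: gauss_density_def inv det_I diff_zero matrix_vector_mul_lid mult_1_right real_sqrt_power)
        (simp add: power_one_over)
  qed
  have "has_bochner_integral lborel (\<lambda>z::real^'n. \<Prod>i\<in>UNIV. std_normal_density (z $ i) * (z $ i) ^ e i)
    (\<Prod>i\<in>UNIV. \<integral>y. std_normal_density y * y ^ e i \<partial>lborel)"
    by (rule has_bochner_integral_lborel_prod) (rule integrable_std_normal_moment)
  then have *: "has_bochner_integral lborel (\<lambda>z::real^'n. gauss_density 0 (mat 1) z *\<^sub>R (\<Prod>i\<in>UNIV. (z $ i) ^ e i))
    (\<Prod>i\<in>UNIV. \<integral>y. std_normal_density y * y ^ e i \<partial>lborel)"
    by (simp add: dens prod.distrib)
  show ?thesis unfolding gaussian_eq_density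
    by (rule has_bochner_integral_density[OF _ _ _ *]) (auto simp: dens intro!: prod_nonneg)
qed

lemma std_normal_moments:
  "(\<integral>y. std_normal_density y * y ^ 0 \<partial>lborel) = 1"
  "(\<integral>y. std_normal_density y * y ^ 1 \<partial>lborel) = 0"
  "(\<integral>y. std_normal_density y * y ^ 2 \<partial>lborel) = 1"
  using integral_std_normal_moment_even[of 0] integral_std_normal_moment_odd[of 0]
    integral_std_normal_moment_even[of 1] by (simp_all add: fact_numeral)

lemma std_gaussian_affine_square:
  fixes v :: "real^'n"
  shows "has_bochner_integral (gaussian 0 (mat 1)) (\<lambda>z. (v \<bullet> z + c)\<^sup>2) (v \<bullet> v + c\<^sup>2)"
proof -
  let ?G = "gaussian 0 (mat 1 :: real^'n^'n)"
  let ?I = "\<lambda>k. \<integral>y. std_normal_density y * y ^ k \<partial>lborel"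
  have M0: "has_bochner_integral ?G (\<lambda>z. 1) (1::real)"
    using std_gaussian_moment[of "\<lambda>_::'n. 0"] std_normal_moments(1) by simp
  have M1: "has_bochner_integral ?G (\<lambda>z. z $ i) 0" for i :: 'n
  proof -
    have fn: "(\<Prod>k\<in>UNIV. (z $ k) ^ of_bool (k = i)) = z $ i" for z :: "real^'n"
      by (simp add: of_bool_def if_distrib[of "\<lambda>k. _ ^ k"] cong: if_cong)
    have "?I (of_bool (i = i)) = 0" using std_normal_moments(2) by simp
    then have "(\<Prod>k\<in>UNIV. ?I (of_bool (k = i))) = 0"
      by (intro prod_zero bexI[of _ i]) simp_all
    then show ?thesis using std_gaussian_moment[of "\<lambda>k::'n. of_bool (k = i)"]
      by (simp only: fn)
  qed
  have M2: "has_bochner_integral ?G (\<lambda>z. z $ i * z $ j) (of_bool (i = j))" for i j :: 'n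
  proof -
    have fn: "(\<Prod>k\<in>UNIV. (z $ k) ^ (of_bool (k = i) + of_bool (k = j))) = z $ i * z $ j" for z :: "real^'n"
      by (simp add: power_add prod.distrib of_bool_def if_distrib[of "\<lambda>k. _ ^ k"] cong: if_cong)
    have "(\<Prod>k\<in>UNIV. ?I (of_bool (k = i) + of_bool (k = j))) = of_bool (i = j)"
    proof (cases "i = j")
      case True
      then have "?I (of_bool (k = i) + of_bool (k = j)) = 1" for k
        using std_normal_moments(1,3) by (cases "k = i") (simp_all add: numeral_2_eq_2)
      with True show ?thesis by simp
    next
      case False
      then have "?I (of_bool (i = i) + of_bool (i = j)) = 0" using std_normal_moments(2) by simp
      then have "(\<Prod>k\<in>UNIV. ?I (of_bool (k = i) + of_bool (k = j))) = 0"
        by (intro prod_zero bexI[of _ i]) simp_all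
      with False show ?thesis by simp
    qed
    then show ?thesis using std_gaussian_moment[of "\<lambda>k::'n. of_bool (k = i) + of_bool (k = j)"]
      by (simp only: fn)
  qed
  have "has_bochner_integral ?G
     (\<lambda>z. (\<Sum>i\<in>UNIV. \<Sum>j\<in>UNIV. (v $ i * v $ j) * (z $ i * z $ j)) + (\<Sum>i\<in>UNIV. (2 * c * v $ i) * z $ i) + c\<^sup>2 * 1)
     ((\<Sum>i\<in>UNIV. \<Sum>j\<in>UNIV. (v $ i * v $ j) * of_bool (i = j)) + (\<Sum>i\<in>UNIV. (2 * c * v $ i) * 0) + c\<^sup>2 * 1)"
    by (intro has_bochner_integral_add has_bochner_integral_sum has_bochner_integral_mult_right M0 M1 M2)
  moreover have "(\<Sum>i\<in>UNIV. \<Sum>j\<in>UNIV. (v $ i * v $ j) * (z $ i * z $ j)) + (\<Sum>i\<in>UNIV. (2 * c * v $ i) * z $ i) + c\<^sup>2 * 1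
     = (v \<bullet> z + c)\<^sup>2" for z
  proof -
    have "(v \<bullet> z)\<^sup>2 = (\<Sum>i\<in>UNIV. \<Sum>j\<in>UNIV. (v $ i * v $ j) * (z $ i * z $ j))"
      unfolding inner_vec_def power2_eq_square sum_product by (intro sum.cong refl) simp
    moreover have "2 * c * (v \<bullet> z) = (\<Sum>i\<in>UNIV. (2 * c * v $ i) * z $ i)"
      unfolding inner_vec_def sum_distrib_left by (intro sum.cong refl) simp
    moreover have "(v \<bullet> z + c)\<^sup>2 = (v \<bullet> z)\<^sup>2 + 2 * c * (v \<bullet> z) + c\<^sup>2 * 1"
      by (simp add: power2_sum)
    ultimately show ?thesis by (simp only:)
  qed
  moreover have "(\<Sum>i\<in>UNIV. \<Sum>j\<in>UNIV. (v $ i * v $ j) * of_bool (i = j)) = v \<bullet> v"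
    by (simp add: inner_vec_def of_bool_def if_distrib cong: if_cong)
  ultimately show ?thesis by simp
qed

lemma pd_mat_1: "pd_mat (mat 1 :: real^'n^'n)"
  by (simp add: pd_mat_def sym_mat_def)

text \<open>Second moments are all that the divergence needs, since the averaged increase of the potential
is a weighted sum of squares of affine functions. They also identify mean and covariance, see
\<open>gaussian_inject\<close>. The general case is the image of the standard one under \<open>z \<mapsto> S\<^sup>1\<^sup>/\<^sup>2 z + m\<close>.\<close>

lemma gaussian_affine_square:
  fixes v :: "real^'n"
  assumes S: "pd_mat S"
  shows "has_bochner_integral (gaussian m S) (\<lambda>x. (v \<bullet> x + c)\<^sup>2) (v \<bullet> (S *v v) + (v \<bullet> m + c)\<^sup>2)"
proof -
  let ?L = "mat_sqrt S"
  have L: "pd_mat ?L" "?L ** ?L = S" "sym_mat ?L"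
    using pd_mat_sqrt[OF S] psd_mat_sqrt_properties[OF pd_imp_psd[OF S]] by (auto simp: pd_mat_def)
  have G: "gaussian m S = distr (gaussian 0 (mat 1)) borel (\<lambda>z. ?L *v z + m)"
    using gaussian_affine[OF L(1) pd_mat_1, of 0 m] by (simp add: L(2))
  have "has_bochner_integral (gaussian 0 (mat 1)) (\<lambda>z. ((?L *v v) \<bullet> z + (v \<bullet> m + c))\<^sup>2)
     ((?L *v v) \<bullet> (?L *v v) + (v \<bullet> m + c)\<^sup>2)"
    by (rule std_gaussian_affine_square)
  moreover have "(?L *v v) \<bullet> z + (v \<bullet> m + c) = v \<bullet> (?L *v z + m) + c" for z
    by (simp add: inner_sym_mat[OF L(3)] inner_add_right)
  moreover have "(?L *v v) \<bullet> (?L *v v) = v \<bullet> (S *v v)"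
    using inner_sym_mat[OF L(3), of v "?L *v v"] L(2) by (simp add: matrix_vector_mul_assoc)
  ultimately have *: "has_bochner_integral (gaussian 0 (mat 1)) (\<lambda>z. (v \<bullet> (?L *v z + m) + c)\<^sup>2)
     (v \<bullet> (S *v v) + (v \<bullet> m + c)\<^sup>2)" by simp
  show ?thesis unfolding G
    by (rule has_bochner_integral_distr[where f = "\<lambda>x. (v \<bullet> x + c)\<^sup>2", OF _ _ *]) measurable
qed

lemma sym_mat_eq_of_quad:
  fixes A B :: "real^'n^'n"
  assumes A: "sym_mat A" and B: "sym_mat B" and eq: "\<And>v. v \<bullet> (A *v v) = v \<bullet> (B *v v)"
  shows "A = B"
proof -
  have pol: "v \<bullet> (A *v w) = v \<bullet> (B *v w)" for v w
  proof -
    have "2 * (v \<bullet> (M *v w)) = (v + w) \<bullet> (M *v (v + w)) - v \<bullet> (M *v v) - w \<bullet> (M *v w)" if "sym_mat M" for M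
      using inner_sym_mat[OF that, of w v]
      by (simp add: matrix_vector_right_distrib inner_add_left inner_add_right inner_commute)
    from this[OF A] this[OF B] eq show ?thesis by simp
  qed
  have "A *v w = B *v w" for w
    using pol vector_eq_ldot by blast
  then show ?thesis by (simp add: matrix_eq)
qed

text \<open>Comparing the second moments of \<open>v \<bullet> x + c\<close> for \<open>c = 0\<close> and \<open>c = 1\<close> separates the mean; the
rest is polarisation.\<close>

lemma gaussian_inject:
  fixes m m' :: "real^'n"
  assumes S: "pd_mat S" and S': "pd_mat S'" and eq: "gaussian m S = gaussian m' S'"
  shows "m = m'" "S = S'"
proof -
  have moments: "v \<bullet> (S *v v) + (v \<bullet> m + c)\<^sup>2 = v \<bullet> (S' *v v) + (v \<bullet> m' + c)\<^sup>2" for v c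
    using gaussian_affine_square[OF S, of m v c] gaussian_affine_square[OF S', of m' v c]
    unfolding eq by (rule has_bochner_integral_eq)
  have "v \<bullet> m = v \<bullet> m'" for v
    using moments[of v 1] moments[of v 0] by (simp add: power2_eq_square algebra_simps)
  then show m: "m = m'" using vector_eq_ldot by blast
  have "v \<bullet> (S *v v) = v \<bullet> (S' *v v)" for v using moments[of v 0] by (simp add: m)
  then show "S = S'" using S S' by (intro sym_mat_eq_of_quad) (auto simp: pd_mat_def)
qed

section \<open>The transport matrix\<close>

definition transport_mat :: "real^'n^'n \<Rightarrow> real^'n^'n \<Rightarrow> real^'n^'n" where
  "transport_mat S0 S1 = matrix_inv (mat_sqrt S0) ** mat_sqrt (mat_sqrt S0 ** S1 ** mat_sqrt S0)
     ** matrix_inv (mat_sqrt S0)"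

lemma transport_mat:
  assumes S0: "pd_mat S0" and S1: "pd_mat S1"
  shows "pd_mat (transport_mat S0 S1)" "transport_mat S0 S1 ** S0 ** transport_mat S0 S1 = S1"
proof -
  define s where "s = mat_sqrt S0"
  define q where "q = mat_sqrt (s ** S1 ** s)"
  define i where "i = matrix_inv s"
  have T: "transport_mat S0 S1 = i ** q ** i"
    by (simp only: transport_mat_def s_def q_def i_def)
  have s: "pd_mat s" "s ** s = S0"
    using pd_mat_sqrt[OF S0] psd_mat_sqrt_properties(2)[OF pd_imp_psd[OF S0]] by (auto simp: s_def)
  have P: "pd_mat (s ** S1 ** s)" by (rule pd_mat_congruence[OF S1 s(1)])
  have q: "pd_mat q" "q ** q = s ** S1 ** s"
    using pd_mat_sqrt[OF P] psd_mat_sqrt_properties(2)[OF pd_imp_psd[OF P]] by (auto simp: q_def)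
  have i: "s ** i = mat 1" "i ** s = mat 1" using matrix_inv_pd[OF s(1)] by (auto simp: i_def)
  show "pd_mat (transport_mat S0 S1)"
    unfolding T i_def by (rule pd_mat_congruence[OF q(1) pd_mat_inv[OF s(1)]])
  have "transport_mat S0 S1 ** S0 ** transport_mat S0 S1
    = i ** q ** (i ** s) ** (s ** i) ** q ** i"
    unfolding T by (simp only: s(2)[symmetric] matrix_mul_assoc)
  also have "\<dots> = i ** (q ** q) ** i"
    by (simp only: i matrix_mul_rid) (simp only: matrix_mul_assoc)
  also have "\<dots> = (i ** s) ** S1 ** (s ** i)" by (simp only: q(2) matrix_mul_assoc)
  also have "\<dots> = S1" by (simp only: i matrix_mul_rid matrix_mul_lid)
  finally show "transport_mat S0 S1 ** S0 ** transport_mat S0 S1 = S1" .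
qed

text \<open>Conjugating \<open>X S0 X = S1\<close> with \<open>s = S0\<^sup>1\<^sup>/\<^sup>2\<close> turns it into \<open>(s X s)\<^sup>2 = s S1 s\<close>, where the
positive semidefinite root is unique.\<close>

lemma transport_mat_unique:
  assumes S0: "pd_mat S0" and X: "pd_mat X" and eq: "X ** S0 ** X = S1"
  shows "X = transport_mat S0 S1"
proof -
  define s where "s = mat_sqrt S0"
  define i where "i = matrix_inv s"
  have T: "transport_mat S0 S1 = i ** mat_sqrt (s ** S1 ** s) ** i"
    by (simp only: transport_mat_def s_def i_def)
  have s: "pd_mat s" "s ** s = S0"
    using pd_mat_sqrt[OF S0] psd_mat_sqrt_properties(2)[OF pd_imp_psd[OF S0]] by (auto simp: s_def)
  have i: "s ** i = mat 1" "i ** s = mat 1" using matrix_inv_pd[OF s(1)] by (auto simp: i_def)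
  have "(s ** X ** s) ** (s ** X ** s) = s ** (X ** (s ** s) ** X) ** s"
    by (simp only: matrix_mul_assoc)
  also have "\<dots> = s ** S1 ** s" by (simp only: s(2) eq)
  finally have "mat_sqrt (s ** S1 ** s) = s ** X ** s"
    by (rule mat_sqrt_unique[OF pd_imp_psd[OF pd_mat_congruence[OF X s(1)]]])
  then have "transport_mat S0 S1 = (i ** s) ** X ** (s ** i)"
    by (simp only: T matrix_mul_assoc)
  then show ?thesis by (simp only: i matrix_mul_rid matrix_mul_lid)
qed

text \<open>When the covariances commute, so do their square roots \<open>s\<close> and \<open>t\<close>, and \<open>t s\<^sup>-\<^sup>1\<close> solves
the equation that characterises the transport matrix.\<close>

lemma transport_mat_commuting:
  assumes S0: "pd_mat S0" and S1: "pd_mat S1" and comm: "S0 ** S1 = S1 ** S0"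
  shows "transport_mat S0 S1 ** mat_sqrt S0 = mat_sqrt S1"
proof -
  define s t where "s = mat_sqrt S0" and "t = mat_sqrt S1"
  obtain V d where V: "orthogonal_matrix V" and S0d: "S0 = spectral_mat V d" and d: "\<And>i. 0 < d i"
    using pd_mat_spectral[OF S0] by blast
  obtain W e where W: "orthogonal_matrix W" and S1e: "S1 = spectral_mat W e" and e: "\<And>i. 0 < e i"
    using pd_mat_spectral[OF S1] by blast
  have s: "s = spectral_mat V (\<lambda>i. sqrt (d i))" "s ** s = S0"
    using mat_sqrt_spec[OF V] d psd_mat_sqrt_properties(2)[OF pd_imp_psd[OF S0]]
    by (simp_all add: S0d s_def less_imp_le)
  have t: "t = spectral_mat W (\<lambda>i. sqrt (e i))" "t ** t = S1" "pd_mat t"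
    using mat_sqrt_spec[OF W] e psd_mat_sqrt_properties(2)[OF pd_imp_psd[OF S1]] pd_mat_sqrt[OF S1]
    by (simp_all add: S1e t_def less_imp_le)
  have "S1 ** spectral_mat V d = spectral_mat V d ** S1" using comm S0d by simp
  then have "S1 ** s = s ** S1" unfolding s(1) by (rule commute_spec[OF V]) simp
  then have "s ** spectral_mat W e = spectral_mat W e ** s" using S1e by simp
  then have "s ** t = t ** s" unfolding t(1) by (rule commute_spec[OF W]) simp
  then have ts: "t ** s = s ** t" by simp
  \<comment> \<open>The inverse square root of \<open>s\<close> makes \<open>t s\<^sup>-\<^sup>1 = h t h\<close> visibly positive definite.\<close>
  define h where "h = spectral_mat V (\<lambda>i. inverse (sqrt (sqrt (d i))))"
  define k where "k = spectral_mat V (\<lambda>i. inverse (sqrt (d i)))"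
  have th: "t ** h = h ** t" unfolding h_def
    by (rule commute_spec[OF V ts[unfolded s(1)]]) simp
  have hh: "h ** h = k"
    using d by (simp add: h_def k_def spec_mult[OF V] inverse_mult_distrib[symmetric] less_imp_le
        del: inverse_mult_distrib)
  have "sqrt (d i) \<noteq> 0" for i using d[of i] by simp
  then have k: "k ** s = mat 1" "s ** k = mat 1"
    by (simp_all add: k_def s(1) spec_mult[OF V] spec_one[OF V])
  have h: "pd_mat h" unfolding h_def pd_spec_iff[OF V] using d by simp
  have X: "h ** t ** h = t ** k"
    by (simp only: th[symmetric]) (simp only: matrix_mul_assoc[symmetric] hh)
  have "(t ** k) ** S0 ** (t ** k) = t ** (k ** s) ** s ** t ** k"
    by (simp only: s(2)[symmetric] matrix_mul_assoc)
  also have "\<dots> = t ** (s ** t) ** k" by (simp only: k matrix_mul_rid matrix_mul_assoc)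
  also have "\<dots> = (t ** t) ** (s ** k)" by (simp only: ts[symmetric] matrix_mul_assoc)
  also have "\<dots> = S1" by (simp only: k t(2) matrix_mul_rid)
  finally have "(t ** k) ** S0 ** (t ** k) = S1" .
  moreover have "pd_mat (t ** k)" using pd_mat_congruence[OF t(3) h] X by simp
  ultimately have R: "transport_mat S0 S1 = t ** k" using transport_mat_unique[OF S0] by metis
  show "transport_mat S0 S1 ** mat_sqrt S0 = mat_sqrt S1"
    unfolding s_def[symmetric] t_def[symmetric] R by (simp only: matrix_mul_assoc[symmetric] k matrix_mul_rid)
qed

section \<open>The divergence in an eigenbasis of the transport matrix\<close>

text \<open>The time-one flow of \<open>(1/2) x \<bullet> A x + b \<bullet> x\<close> is \<open>x \<mapsto> exp A x + K\<^sub>1(A) b\<close> with \<open>exp A\<close>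
positive definite. Pushing the first Gaussian to the second one means matching the covariances, which
makes \<open>exp A\<close> the transport matrix, and the means, which determines \<open>b\<close> because \<open>K\<^sub>1(A)\<close> is
invertible.\<close>

lemma wkl_potential_gaussian:
  fixes m0 m1 :: "real^'n"
  assumes S0: "pd_mat S0" and S1: "pd_mat S1" and U: "orthogonal_matrix U"
    and R: "transport_mat S0 S1 = spectral_mat U (\<lambda>i. exp (a i))"
  defines "b \<equiv> spectral_mat U (\<lambda>i. inverse (duhamel (a i) 1)) *v (m1 - spectral_mat U (\<lambda>i. exp (a i)) *v m0)"
  shows "wkl_potential (gaussian m0 S0) (gaussian m1 S1) = (\<lambda>x. (1/2) * (x \<bullet> (spectral_mat U a *v x)) + b \<bullet> x)"
  unfolding wkl_potential_def
proof (rule the_equality)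
  have push: "distr (gaussian m0 S0) borel (affine_flow V e c 1)
      = gaussian (spectral_mat V (\<lambda>i. exp (e i)) *v m0 + spectral_mat V (\<lambda>i. duhamel (e i) 1) *v c)
          (spectral_mat V (\<lambda>i. exp (e i)) ** S0 ** spectral_mat V (\<lambda>i. exp (e i)))"
    if V: "orthogonal_matrix V" for V :: "real^'n^'n" and e c
  proof -
    have "pd_mat (spectral_mat V (\<lambda>i. exp (e i)))" by (simp add: pd_spec_iff[OF V])
    from gaussian_affine[OF this S0, of m0 "spectral_mat V (\<lambda>i. duhamel (e i) 1) *v c"] show ?thesis
      by (simp add: affine_flow_def[abs_def])
  qed
  have Kb: "spectral_mat U (\<lambda>i. duhamel (a i) 1) *v b = m1 - spectral_mat U (\<lambda>i. exp (a i)) *v m0"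
    by (rule coord_eqI[OF U])
      (simp add: b_def coord_spec[OF U] duhamel_pos[THEN less_imp_neq, THEN not_sym])
  show "quadratic_potential (\<lambda>x. (1/2) * (x \<bullet> (spectral_mat U a *v x)) + b \<bullet> x) \<and>
    distr (gaussian m0 S0) borel (gradient_flow (\<lambda>x. (1/2) * (x \<bullet> (spectral_mat U a *v x)) + b \<bullet> x) 1) = gaussian m1 S1"
  proof
    show "quadratic_potential (\<lambda>x. (1/2) * (x \<bullet> (spectral_mat U a *v x)) + b \<bullet> x)"
      unfolding quadratic_potential_def using sym_mat_spec by blast
    show "distr (gaussian m0 S0) borel (gradient_flow (\<lambda>x. (1/2) * (x \<bullet> (spectral_mat U a *v x)) + b \<bullet> x) 1) = gaussian m1 S1"
      unfolding gradient_flow_quadratic[OF U] push[OF U] Kb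
      using transport_mat(2)[OF S0 S1] by (simp add: R)
  qed
  fix f assume f: "quadratic_potential f \<and> distr (gaussian m0 S0) borel (gradient_flow f 1) = gaussian m1 S1"
  then obtain A c where A: "sym_mat A" and fA: "f = (\<lambda>x. (1/2) * (x \<bullet> (A *v x)) + c \<bullet> x)"
    unfolding quadratic_potential_def by blast
  obtain V e where V: "orthogonal_matrix V" and Ae: "A = spectral_mat V e"
    using sym_mat_spectral[OF A] by blast
  let ?L = "spectral_mat V (\<lambda>i. exp (e i))"
  have L: "pd_mat ?L" by (simp add: pd_spec_iff[OF V])
  have eq: "gaussian (?L *v m0 + spectral_mat V (\<lambda>i. duhamel (e i) 1) *v c) (?L ** S0 ** ?L) = gaussian m1 S1"
    using f unfolding fA Ae gradient_flow_quadratic[OF V] push[OF V] by blast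
  note inj = gaussian_inject[OF pd_mat_congruence[OF S0 L] S1 eq]
  have LR: "?L = spectral_mat U (\<lambda>i. exp (a i))"
    using transport_mat_unique[OF S0 L inj(2)] R by simp
  have "spectral_mat V (\<lambda>i. (\<lambda>x. x) (e i)) = spectral_mat U (\<lambda>i. (\<lambda>x. x) (a i))"
    by (rule spec_transfer[where g = exp, OF V U LR]) simp
  then have Aa: "A = spectral_mat U a" by (simp add: Ae)
  have K: "spectral_mat V (\<lambda>i. duhamel (e i) 1) = spectral_mat U (\<lambda>i. duhamel (a i) 1)"
    by (rule spec_transfer[where g = exp, OF V U LR]) simp
  have "spectral_mat U (\<lambda>i. duhamel (a i) 1) *v c = m1 - spectral_mat U (\<lambda>i. exp (a i)) *v m0"
    using inj(1) unfolding LR K by (simp add: algebra_simps)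
  then have "spectral_mat U (\<lambda>i. duhamel (a i) 1) *v c = spectral_mat U (\<lambda>i. duhamel (a i) 1) *v b" by (simp add: Kb)
  then have "duhamel (a i) 1 * (c v* U) $ i = duhamel (a i) 1 * (b v* U) $ i" for i
    by (metis coord_spec[OF U])
  then have "c = b"
    by (intro coord_eqI[OF U]) (simp add: duhamel_pos[THEN less_imp_neq, THEN not_sym])
  then show "f = (\<lambda>x. (1/2) * (x \<bullet> (spectral_mat U a *v x)) + b \<bullet> x)" by (simp add: fA Aa)
qed

text \<open>The expectation of the squared gradient component \<open>a x + b\<close> splits into its variance and the
square of its mean, and matching the means of the two measures makes its mean the mean difference divided by
\<open>duhamel a 1\<close>.\<close>

lemma D_WKL_gaussian_coord:
  fixes m0 m1 :: "real^'n"
  assumes S0: "pd_mat S0" and S1: "pd_mat S1" and U: "orthogonal_matrix U"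
    and R: "transport_mat S0 S1 = spectral_mat U (\<lambda>i. exp (a i))"
  shows "D_WKL (gaussian m0 S0) (gaussian m1 S1) = (\<Sum>i\<in>UNIV. wkl_weight (a i) *
     ((a i)\<^sup>2 * (column i U \<bullet> (S0 *v column i U)) + (((m1 - m0) v* U) $ i / duhamel (a i) 1)\<^sup>2))"
proof -
  define b where "b = spectral_mat U (\<lambda>i. inverse (duhamel (a i) 1)) *v (m1 - spectral_mat U (\<lambda>i. exp (a i)) *v m0)"
  let ?f = "\<lambda>x. (1/2) * (x \<bullet> (spectral_mat U a *v x)) + b \<bullet> x"
  have pot: "wkl_potential (gaussian m0 S0) (gaussian m1 S1) = ?f"
    unfolding b_def by (rule wkl_potential_gaussian[OF S0 S1 U R])
  have "D_WKL (gaussian m0 S0) (gaussian m1 S1)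
    = (\<integral>x. (\<Sum>i\<in>UNIV. wkl_weight (a i) * (a i * (x v* U) $ i + (b v* U) $ i)\<^sup>2) \<partial>gaussian m0 S0)"
    unfolding D_WKL_def Let_def pot gradient_flow_quadratic[OF U] potential_drop_integral[OF U] ..
  also have "\<dots> = (\<Sum>i\<in>UNIV. wkl_weight (a i) *
     ((a i)\<^sup>2 * (column i U \<bullet> (S0 *v column i U)) + (a i * (m0 v* U) $ i + (b v* U) $ i)\<^sup>2))"
  proof (rule has_bochner_integral_integral_eq, intro has_bochner_integral_sum has_bochner_integral_mult_right)
    fix i
    show "has_bochner_integral (gaussian m0 S0) (\<lambda>x. (a i * (x v* U) $ i + (b v* U) $ i)\<^sup>2)
      ((a i)\<^sup>2 * (column i U \<bullet> (S0 *v column i U)) + (a i * (m0 v* U) $ i + (b v* U) $ i)\<^sup>2)"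
      using gaussian_affine_square[OF S0, of m0 "a i *\<^sub>R column i U" "(b v* U) $ i"]
      by (simp add: coord_eq_inner inner_commute matrix_vector_mult_scaleR power2_eq_square mult.assoc)
  qed
  also have "\<dots> = (\<Sum>i\<in>UNIV. wkl_weight (a i) *
     ((a i)\<^sup>2 * (column i U \<bullet> (S0 *v column i U)) + (((m1 - m0) v* U) $ i / duhamel (a i) 1)\<^sup>2))"
  proof (intro sum.cong refl)
    fix i
    have d: "duhamel (a i) 1 \<noteq> 0" using duhamel_pos[of "a i"] by simp
    have "(b v* U) $ i = ((m1 v* U) $ i - exp (a i) * (m0 v* U) $ i) / duhamel (a i) 1"
      by (simp add: b_def coord_spec[OF U] coord_diff divide_inverse mult.commute)
    moreover have "exp (a i) = a i * duhamel (a i) 1 + 1" using exp_eq_duhamel[of "a i" 1] by simp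
    ultimately have "a i * (m0 v* U) $ i + (b v* U) $ i = ((m1 - m0) v* U) $ i / duhamel (a i) 1"
      using d by (simp add: coord_diff field_simps)
    then show "wkl_weight (a i) * ((a i)\<^sup>2 * (column i U \<bullet> (S0 *v column i U)) + (a i * (m0 v* U) $ i + (b v* U) $ i)\<^sup>2)
      = wkl_weight (a i) * ((a i)\<^sup>2 * (column i U \<bullet> (S0 *v column i U)) + (((m1 - m0) v* U) $ i / duhamel (a i) 1)\<^sup>2)"
      by simp
  qed
  finally show ?thesis .
qed

lemma norm_mat_sqrt_square:
  assumes "psd_mat M"
  shows "(norm (mat_sqrt M *v x))\<^sup>2 = x \<bullet> (M *v x)"
proof -
  have s: "sym_mat (mat_sqrt M)" "mat_sqrt M ** mat_sqrt M = M"
    using psd_mat_sqrt_properties[OF assms] by (auto simp: psd_mat_def)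
  have "(norm (mat_sqrt M *v x))\<^sup>2 = (mat_sqrt M *v x) \<bullet> (mat_sqrt M *v x)"
    by (rule power2_norm_eq_inner)
  also have "\<dots> = x \<bullet> (M *v x)"
    using inner_sym_mat[OF s(1), of x "mat_sqrt M *v x"] by (simp add: matrix_vector_mul_assoc s(2))
  finally show ?thesis .
qed

lemma frobenius_norm_square:
  fixes A :: "real^'n^'m"
  shows "(norm A)\<^sup>2 = trace (transpose A ** A)"
proof -
  have "(norm A)\<^sup>2 = (\<Sum>i\<in>UNIV. \<Sum>j\<in>UNIV. A $ i $ j * A $ i $ j)"
    by (simp only: power2_norm_eq_inner inner_vec_def inner_real_def)
  also have "\<dots> = (\<Sum>j\<in>UNIV. \<Sum>i\<in>UNIV. A $ i $ j * A $ i $ j)" by (rule sum.swap)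
  finally show ?thesis by (simp add: trace_def matrix_matrix_mult_def transpose_def)
qed

lemma matrix_mult_add_right_distrib: "(A + B) ** C = A ** C + B ** C" for A B :: "real^'n^'m" and C :: "real^'k^'n"
  by (simp add: vec_eq_iff matrix_matrix_mult_def algebra_simps sum.distrib)

lemma mult_ln_ge: "0 \<le> ln y * y - y + 1" if "0 < y" for y :: real
proof -
  have "ln (1 / y) \<le> 1 / y - 1" by (rule ln_le_minus_one) (use that in simp)
  then have "y * - ln y \<le> y * (1 / y - 1)" using that by (intro mult_left_mono) (simp_all add: ln_div)
  then show ?thesis using that by (simp add: algebra_simps)
qed

text \<open>Each eigenvalue contributes to the mean term in one of two ways. For \<open>a \<noteq> 0\<close> the factor is the
eigenvalue of \<open>Q\<close>; for \<open>a = 0\<close> that eigenvalue is zero through \<open>inverse 0 = 0\<close> and the projector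
onto the kernel of \<open>log R\<close>, with eigenvalue \<open>1 - a * inverse a\<close>, supplies the factor.\<close>

lemma wkl_weight_mean:
  fixes a :: real
  defines "r \<equiv> exp a"
  shows "4 * (wkl_weight a * (x / duhamel a 1)\<^sup>2)
    = (inverse (r - 1) * (ln (r * r) * (r * r) - r * r + 1) * inverse (r - 1) + 2 * (1 - a * inverse a)) * x\<^sup>2"
proof (cases "a = 0")
  case True
  then show ?thesis by (simp add: r_def wkl_weight_def duhamel_def)
next
  case False
  have k: "ln (r * r) * (r * r) - r * r + 1 = 4 * (a\<^sup>2 * wkl_weight a)"
    using wkl_weight_eq[of a] by (simp add: r_def power2_eq_square)
  have D: "x / duhamel a 1 = a * x * inverse (r - 1)"
    using False by (simp add: duhamel_def r_def divide_inverse mult_ac)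
  have "1 - a * inverse a = 0" using False by simp
  then show ?thesis unfolding k D by (simp add: power2_eq_square mult_ac)
qed

theorem theorem7:
  fixes m0 m1 :: "real^'n" and S0 S1 R Q :: "real^'n^'n"
  assumes S0: "pd_mat S0" and S1: "pd_mat S1"
    and R: "R = matrix_inv (mat_sqrt S0) ** mat_sqrt (mat_sqrt S0 ** S1 ** mat_sqrt S0)
                  ** matrix_inv (mat_sqrt S0)"
    and Q: "Q = mat_pinv (R - mat 1) ** (mat_log (R ** R) ** (R ** R) - R ** R + mat 1)
                  ** mat_pinv (R - mat 1)"
  shows "D_WKL (gaussian m0 S0) (gaussian m1 S1) =
           (1/4) * trace (S0 - S1 + S0 ** (R ** R) ** mat_log (R ** R))
         + (1/4) * (norm (mat_sqrt (Q + 2 *\<^sub>R mat_perp (mat_log R)) *v (m1 - m0)))\<^sup>2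
       \<and> (S0 ** S1 = S1 ** S0 \<longrightarrow>
           D_WKL (gaussian m0 S0) (gaussian m1 S1) =
             (1/4) * ((norm (mat_sqrt Q ** (mat_sqrt S1 - mat_sqrt S0)))\<^sup>2
                    + (norm (mat_sqrt (Q + 2 *\<^sub>R mat_perp (mat_log R)) *v (m1 - m0)))\<^sup>2))"
proof -
  have RT: "R = transport_mat S0 S1" by (simp add: R transport_mat_def)
  obtain U r where U: "orthogonal_matrix U" and Rr: "R = spectral_mat U r" and r: "\<And>i. 0 < r i"
    using pd_mat_spectral[OF transport_mat(1)[OF S0 S1]] RT by blast
  define a where "a i = ln (r i)" for i
  have ra: "r = (\<lambda>i. exp (a i))" using r by (simp add: a_def fun_eq_iff)
  let ?k = "\<lambda>i. ln (r i * r i) * (r i * r i) - r i * r i + 1"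
  let ?q = "\<lambda>i. inverse (r i - 1) * ?k i * inverse (r i - 1)"
  let ?p = "\<lambda>i. 1 - a i * inverse (a i)"
  let ?S = "\<lambda>i. column i U \<bullet> (S0 *v column i U)"
  let ?M = "Q + 2 *\<^sub>R mat_perp (mat_log R)"
  note one = spec_one[OF U, symmetric]
  have R2: "R ** R = spectral_mat U (\<lambda>i. r i * r i)" by (simp add: Rr spec_mult[OF U])
  have log2: "mat_log (R ** R) = spectral_mat U (\<lambda>i. ln (r i * r i))"
    unfolding R2 by (rule mat_log_spec[OF U]) (simp add: r)
  have K: "mat_log (R ** R) ** (R ** R) - R ** R + mat 1 = spectral_mat U ?k"
    unfolding log2 unfolding R2 one spec_mult[OF U] spec_diff spec_add ..
  have Qq: "Q = spectral_mat U ?q"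
    unfolding Q K unfolding Rr one spec_diff mat_pinv_spec[OF U] spec_mult[OF U] ..
  have "mat_log R = spectral_mat U a"
    unfolding Rr a_def by (rule mat_log_spec[OF U r])
  then have "mat_perp (mat_log R) = spectral_mat U ?p"
    by (simp only: mat_perp_def one mat_pinv_spec[OF U] spec_mult[OF U] spec_diff)
  then have M: "?M = spectral_mat U (\<lambda>i. ?q i + 2 * ?p i)"
    by (simp only: Qq spec_scaleR spec_add)
  have k0: "0 \<le> ?k i" for i using r[of i] by (intro mult_ln_ge) simp
  have q0: "0 \<le> ?q i" for i
  proof -
    have "0 \<le> (inverse (r i - 1) * inverse (r i - 1)) * ?k i"
      by (rule mult_nonneg_nonneg[OF zero_le_square k0])
    then show ?thesis by (simp only: mult.assoc mult.commute mult.left_commute)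
  qed
  have p0: "0 \<le> ?p i" for i by (cases "a i = 0") simp_all
  have "psd_mat ?M" unfolding M psd_spec_iff[OF U] using q0 p0 by (metis add_nonneg_nonneg mult_2)
  then have mean: "(norm (mat_sqrt ?M *v (m1 - m0)))\<^sup>2
    = (\<Sum>i\<in>UNIV. (?q i + 2 * ?p i) * (((m1 - m0) v* U) $ i)\<^sup>2)"
    by (simp only: norm_mat_sqrt_square) (simp only: M quad_spec[OF U])
  have cov: "trace (S0 ** spectral_mat U ?k) = (\<Sum>i\<in>UNIV. ?k i * ?S i)" by (rule trace_mult_spec)
  have D: "4 * D_WKL (gaussian m0 S0) (gaussian m1 S1)
    = trace (S0 ** spectral_mat U ?k) + (norm (mat_sqrt ?M *v (m1 - m0)))\<^sup>2"
  proof -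
    have "transport_mat S0 S1 = spectral_mat U (\<lambda>i. exp (a i))" using RT Rr ra by simp
    note D_WKL_gaussian_coord[OF S0 S1 U this, of m0 m1]
    then have "4 * D_WKL (gaussian m0 S0) (gaussian m1 S1) = (\<Sum>i\<in>UNIV. 4 * (wkl_weight (a i) *
     ((a i)\<^sup>2 * ?S i + (((m1 - m0) v* U) $ i / duhamel (a i) 1)\<^sup>2)))"
      by (simp only: sum_distrib_left)
    also have "\<dots> = (\<Sum>i\<in>UNIV. ?k i * ?S i + (?q i + 2 * ?p i) * (((m1 - m0) v* U) $ i)\<^sup>2)"
    proof (intro sum.cong refl)
      fix i
      have ri: "r i = exp (a i)" by (simp add: ra)
      have "?k i = 4 * ((a i)\<^sup>2 * wkl_weight (a i))"
        using wkl_weight_eq[of "a i"] by (simp add: ri power2_eq_square)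
      moreover have "(?q i + 2 * ?p i) * (((m1 - m0) v* U) $ i)\<^sup>2
        = 4 * (wkl_weight (a i) * (((m1 - m0) v* U) $ i / duhamel (a i) 1)\<^sup>2)"
        unfolding ri by (rule wkl_weight_mean[symmetric])
      ultimately show "4 * (wkl_weight (a i) * ((a i)\<^sup>2 * ?S i + (((m1 - m0) v* U) $ i / duhamel (a i) 1)\<^sup>2))
        = ?k i * ?S i + (?q i + 2 * ?p i) * (((m1 - m0) v* U) $ i)\<^sup>2"
        by (simp only:) (simp add: algebra_simps)
    qed
    finally show ?thesis by (simp only: mean cov sum.distrib)
  qed
  have general: "trace (S0 - S1 + S0 ** (R ** R) ** mat_log (R ** R)) = trace (S0 ** spectral_mat U ?k)"
  proof -
    have "trace S1 = trace ((R ** S0) ** R)" using transport_mat(2)[OF S0 S1] RT by simp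
    also have "\<dots> = trace (R ** (R ** S0))" by (rule trace_mul_sym)
    also have "\<dots> = trace ((R ** R) ** S0)" by (simp only: matrix_mul_assoc)
    also have "\<dots> = trace (S0 ** spectral_mat U (\<lambda>i. r i * r i))" unfolding R2 by (rule trace_mul_sym)
    finally have 1: "trace S1 = trace (S0 ** spectral_mat U (\<lambda>i. r i * r i))" .
    have 2: "trace S0 = trace (S0 ** spectral_mat U (\<lambda>i. 1))" by (simp add: spec_one[OF U])
    have 3: "S0 ** (R ** R) ** mat_log (R ** R) = S0 ** spectral_mat U (\<lambda>i. (r i * r i) * ln (r i * r i))"
      unfolding log2 unfolding R2 matrix_mul_assoc[symmetric] spec_mult[OF U] ..
    show ?thesis unfolding trace_add trace_sub 1 2 3 trace_mult_spec sum_subtractf[symmetric] sum.distrib[symmetric]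
      by (intro sum.cong refl) (simp add: algebra_simps)
  qed
  have commuting: "(norm (mat_sqrt Q ** (mat_sqrt S1 - mat_sqrt S0)))\<^sup>2 = trace (S0 ** spectral_mat U ?k)"
    if comm: "S0 ** S1 = S1 ** S0"
  proof -
    let ?s = "mat_sqrt S0"
    let ?D = "R - mat 1"
    have s: "?s ** ?s = S0" "transpose ?s = ?s"
      using psd_mat_sqrt_properties[OF pd_imp_psd[OF S0]] by (auto simp: psd_mat_def sym_mat_def)
    have "psd_mat Q" unfolding Qq psd_spec_iff[OF U] using q0 by blast
    then have qq: "mat_sqrt Q ** mat_sqrt Q = Q" "transpose (mat_sqrt Q) = mat_sqrt Q"
      using psd_mat_sqrt_properties by (auto simp: psd_mat_def sym_mat_def)
    have D1: "mat_sqrt S1 - ?s = spectral_mat U (\<lambda>i. r i - 1) ** ?s"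
    proof -
      have "spectral_mat U (\<lambda>i. r i - 1) ** ?s + ?s = (spectral_mat U (\<lambda>i. r i - 1) + mat 1) ** ?s"
        by (simp add: matrix_mult_add_right_distrib)
      also have "\<dots> = R ** ?s" unfolding one spec_add Rr by simp
      also have "\<dots> = mat_sqrt S1" unfolding RT by (rule transport_mat_commuting[OF S0 S1 comm])
      finally show ?thesis by (simp only: diff_eq_eq)
    qed
    let ?A = "mat_sqrt Q ** (spectral_mat U (\<lambda>i. r i - 1) ** ?s)"
    have "transpose ?A ** ?A = ?s ** spectral_mat U (\<lambda>i. r i - 1) ** (mat_sqrt Q ** mat_sqrt Q) ** spectral_mat U (\<lambda>i. r i - 1) ** ?s"
      by (simp only: matrix_transpose_mul s(2) qq(2) transpose_spec matrix_mul_assoc)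
    also have "\<dots> = ?s ** (spectral_mat U (\<lambda>i. r i - 1) ** Q ** spectral_mat U (\<lambda>i. r i - 1)) ** ?s"
      unfolding qq(1) by (simp only: matrix_mul_assoc)
    also have "spectral_mat U (\<lambda>i. r i - 1) ** Q ** spectral_mat U (\<lambda>i. r i - 1) = spectral_mat U ?k"
    proof -
      \<comment> \<open>For \<open>r i = 1\<close> both sides vanish, so the pseudoinverse loses nothing here.\<close>
      have "(r i - 1) * ?q i * (r i - 1) = ?k i" for i
        by (cases "r i = 1") simp_all
      then show ?thesis unfolding Qq spec_mult[OF U] by (simp only:)
    qed
    finally have "(norm ?A)\<^sup>2 = trace ((?s ** spectral_mat U ?k) ** ?s)" by (simp only: frobenius_norm_square)
    also have "\<dots> = trace (?s ** (?s ** spectral_mat U ?k))" by (rule trace_mul_sym)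
    also have "\<dots> = trace (S0 ** spectral_mat U ?k)" by (simp only: matrix_mul_assoc s(1))
    finally show ?thesis unfolding D1 .
  qed
  show ?thesis using D general commuting by simp
qed

end
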